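(* Let $\mathcal{A}$ be a $C^*$-algebra, $\mathcal{E}$ a right Hilbert $\mathcal{A}$-module, $\mathcal{F}$ a non-trivial closed submodule of $\mathcal{E}$, $\mathcal{H}_1,\mathcal{H}_2$ Hilbert spaces, $\phi:\mathcal{A}\to\mathcal{B}(\mathcal{H}_1)$ a completely positive map and $\Phi:\mathcal{F}\to\mathcal{B}(\mathcal{H}_1,\mathcal{H}_2)$ a completely semi-$\phi$-map. Then there is a completely semi-$\phi$-map $\Phi':\mathcal{E}\to\mathcal{B}(\mathcal{H}_1,\mathcal{H}_2)$ with $\Phi'|_{\mathcal{F}}=\Phi$ such that, furthermore, if $\Phi$ is a $\phi$-map and $\phi(\langle z,x\rangle)=0$ for all $z\in\mathcal{F}^{\perp}$, $x\in\mathcal{E}$, then (i) $\Phi'(z)=0$ for all $z\in\mathcal{F}^{\perp}$; (ii) $\Phi'(x)^*\Phi'(y)=\phi(\langle x,y\rangle)$ and $\Phi'(y)^*\Phi'(x)=\phi(\langle y,x\rangle)$ for all $x\in\mathcal{E}$ and all $y\in\mathcal{F}+\mathcal{F}^{\perp}$.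
   Context: For Hilbert spaces $\mathcal{H},\mathcal{K}$, $\mathcal{B}(\mathcal{H},\mathcal{K})$ is a right Hilbert $\mathcal{B}(\mathcal{H})$-module with module action given by composition and inner product $\langle T,S\rangle=T^*S$. For a Hilbert $C^*$-module $\mathcal{X}$ over $\mathcal{C}$, $\mathbb{M}_n(\mathcal{X})$ denotes $n\times n$ matrices over $\mathcal{X}$, with $\mathbb{M}_n(\mathcal{C})$-valued inner product $(\langle x,y\rangle)_{ij}=\sum_k\langle x_{ki},y_{kj}\rangle$. For a map $\Phi$ let $\Phi_n$ denote its entrywise application to matrices. Given a completely positive map $\phi:\mathcal{A}\to\mathcal{B}(\mathcal{H}_1)$ and a Hilbert $\mathcal{A}$-module $\mathcal{X}$, a map $\Phi:\mathcal{X}\to\mathcal{B}(\mathcal{H}_1,\mathcal{H}_2)$ is a $\phi$-map if $\Phi(x)^*\Phi(y)=\phi(\langle x,y\rangle)$ for all $x,y\in\mathcal{X}$, and a completely semi-$\phi$-map if $\langle\Phi_n(x),\Phi_n(x)\rangle\le\phi_n(\langle x,x\rangle)$ for all $x\in\mathbb{M}_n(\mathcal{X})$ and all $n\in\mathbb{N}$. $\mathcal{F}^{\perp}=\{x\in\mathcal{E}:\langle x,y\rangle=0\text{ for all }y\in\mathcal{F}\}$, a closed submodule of $\mathcal{E}$. *)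

theory Defs
  imports Complex_Main
begin

class complex_vector = ab_group_add +
  fixes scaleC :: "complex \<Rightarrow> 'a \<Rightarrow> 'a" (infixr \<open>*\<^sub>C\<close> 75)
  assumes scaleC_add_right: "a *\<^sub>C (x + y) = a *\<^sub>C x + a *\<^sub>C y"
    and scaleC_add_left: "(a + b) *\<^sub>C x = a *\<^sub>C x + b *\<^sub>C x"
    and scaleC_scaleC: "a *\<^sub>C (b *\<^sub>C x) = (a * b) *\<^sub>C x"
    and scaleC_one: "1 *\<^sub>C x = x"

class complex_normed_vector = complex_vector + real_normed_vector +
  assumes scaleR_scaleC: "scaleR r x = scaleC (complex_of_real r) x"
    and norm_scaleC: "norm (scaleC c x) = cmod c * norm x"

class chilbert_space = complex_normed_vector + complete_space +
  fixes cinner :: "'a \<Rightarrow> 'a \<Rightarrow> complex"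
  assumes cinner_commute: "cinner x y = cnj (cinner y x)"
    and cinner_add_right: "cinner x (y + z) = cinner x y + cinner x z"
    and cinner_scaleC_right: "cinner x (c *\<^sub>C y) = c * cinner x y"
    and cinner_norm: "cinner x x = complex_of_real ((norm x)\<^sup>2)"

class cstar_algebra = complex_normed_vector + complete_space + ring +
  fixes cstar :: "'a \<Rightarrow> 'a"
  assumes norm_mult_le: "norm (x * y) \<le> norm x * norm y"
    and mult_scaleC_left: "(c *\<^sub>C x) * y = c *\<^sub>C (x * y)"
    and mult_scaleC_right: "x * (c *\<^sub>C y) = c *\<^sub>C (x * y)"
    and cstar_cstar: "cstar (cstar x) = x"
    and cstar_add: "cstar (x + y) = cstar x + cstar y"
    and cstar_scaleC: "cstar (c *\<^sub>C x) = cnj c *\<^sub>C cstar x"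
    and cstar_mult: "cstar (x * y) = cstar y * cstar x"
    and cstar_identity: "norm (cstar x * x) = (norm x)\<^sup>2"

definition bounded_clinear :: "('a::complex_normed_vector \<Rightarrow> 'b::complex_normed_vector) \<Rightarrow> bool" where
  "bounded_clinear T \<longleftrightarrow>
     (\<forall>x y. T (x + y) = T x + T y) \<and> (\<forall>c x. T (c *\<^sub>C x) = c *\<^sub>C T x) \<and>
     (\<exists>K. \<forall>x. norm (T x) \<le> norm x * K)"

text \<open>Hilbert-space adjoint T* (unique; exists for bounded T by Riesz).\<close>
definition cadjoint :: "('a::chilbert_space \<Rightarrow> 'b::chilbert_space) \<Rightarrow> 'b \<Rightarrow> 'a" where
  "cadjoint T = (THE S. \<forall>x y. cinner (S y) x = cinner y (T x))"

definition apos :: "'a::cstar_algebra \<Rightarrow> bool" where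
  "apos a \<longleftrightarrow> (\<exists>b. a = cstar b * b)"

text \<open>n x n matrices are functions nat \<Rightarrow> nat \<Rightarrow> _ ; only entries with indices < n matter.
  Positivity in M_n(A) (itself a C*-algebra): a = b* b.\<close>
definition mpos_alg :: "nat \<Rightarrow> (nat \<Rightarrow> nat \<Rightarrow> 'a::cstar_algebra) \<Rightarrow> bool" where
  "mpos_alg n a \<longleftrightarrow> (\<exists>b::nat \<Rightarrow> nat \<Rightarrow> 'a. \<forall>i<n. \<forall>j<n. a i j = (\<Sum>k<n. cstar (b k i) * b k j))"

text \<open>Positivity in M_n(B(H)) = B(H^n): the quadratic form is nonnegative.\<close>
definition mpos_op :: "nat \<Rightarrow> (nat \<Rightarrow> nat \<Rightarrow> 'h::chilbert_space \<Rightarrow> 'h) \<Rightarrow> bool" where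
  "mpos_op n T \<longleftrightarrow> (\<forall>\<xi>::nat \<Rightarrow> 'h.
     Im (\<Sum>i<n. \<Sum>j<n. cinner (\<xi> i) (T i j (\<xi> j))) = 0 \<and>
     Re (\<Sum>i<n. \<Sum>j<n. cinner (\<xi> i) (T i j (\<xi> j))) \<ge> 0)"

definition completely_positive :: "('a::cstar_algebra \<Rightarrow> 'h::chilbert_space \<Rightarrow> 'h) \<Rightarrow> bool" where
  "completely_positive \<phi> \<longleftrightarrow>
     (\<forall>a b. \<phi> (a + b) = (\<lambda>h. \<phi> a h + \<phi> b h)) \<and>
     (\<forall>c a. \<phi> (c *\<^sub>C a) = (\<lambda>h. c *\<^sub>C \<phi> a h)) \<and>
     (\<forall>a. bounded_clinear (\<phi> a)) \<and>
     (\<forall>n a. mpos_alg n a \<longrightarrow> mpos_op n (\<lambda>i j. \<phi> (a i j)))"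

definition hm_norm :: "('e \<Rightarrow> 'e \<Rightarrow> 'a::cstar_algebra) \<Rightarrow> 'e \<Rightarrow> real" where
  "hm_norm ip x = sqrt (norm (ip x x))"

definition hilbert_module :: "('e::complex_vector \<Rightarrow> 'a::cstar_algebra \<Rightarrow> 'e) \<Rightarrow> ('e \<Rightarrow> 'e \<Rightarrow> 'a) \<Rightarrow> bool" where
  "hilbert_module act ip \<longleftrightarrow>
     (\<forall>x y a. act (x + y) a = act x a + act y a) \<and>
     (\<forall>x a b. act x (a + b) = act x a + act x b) \<and>
     (\<forall>x a b. act x (a * b) = act (act x a) b) \<and>
     (\<forall>c x a. act (c *\<^sub>C x) a = c *\<^sub>C act x a) \<and>
     (\<forall>c x a. act x (c *\<^sub>C a) = c *\<^sub>C act x a) \<and>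
     (\<forall>x y z. ip x (y + z) = ip x y + ip x z) \<and>
     (\<forall>x c y. ip x (c *\<^sub>C y) = c *\<^sub>C ip x y) \<and>
     (\<forall>x y a. ip x (act y a) = ip x y * a) \<and>
     (\<forall>x y. cstar (ip x y) = ip y x) \<and>
     (\<forall>x. apos (ip x x)) \<and>
     (\<forall>x. ip x x = 0 \<longrightarrow> x = 0) \<and>
     (\<forall>X::nat \<Rightarrow> 'e. (\<forall>e>0. \<exists>N. \<forall>m\<ge>N. \<forall>n\<ge>N. hm_norm ip (X m - X n) < e) \<longrightarrow>
        (\<exists>L. (\<lambda>n. hm_norm ip (X n - L)) \<longlonglongrightarrow> 0))"

definition closed_submodule ::
  "('e::complex_vector \<Rightarrow> 'a::cstar_algebra \<Rightarrow> 'e) \<Rightarrow> ('e \<Rightarrow> 'e \<Rightarrow> 'a) \<Rightarrow> 'e set \<Rightarrow> bool" where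
  "closed_submodule act ip F \<longleftrightarrow>
     0 \<in> F \<and> (\<forall>x\<in>F. \<forall>y\<in>F. x + y \<in> F) \<and> (\<forall>c. \<forall>x\<in>F. c *\<^sub>C x \<in> F) \<and>
     (\<forall>x\<in>F. \<forall>a. act x a \<in> F) \<and>
     (\<forall>X L. (\<forall>n. X n \<in> F) \<and> (\<lambda>n. hm_norm ip (X n - L)) \<longlonglongrightarrow> 0 \<longrightarrow> L \<in> F)"

definition orth_compl :: "('e \<Rightarrow> 'e \<Rightarrow> 'a::cstar_algebra) \<Rightarrow> 'e set \<Rightarrow> 'e set" where
  "orth_compl ip F = {x. \<forall>y\<in>F. ip x y = 0}"

definition phi_map ::
  "('e \<Rightarrow> 'e \<Rightarrow> 'a::cstar_algebra) \<Rightarrow> ('a \<Rightarrow> 'h1::chilbert_space \<Rightarrow> 'h1) \<Rightarrow> 'e set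
     \<Rightarrow> ('e \<Rightarrow> 'h1 \<Rightarrow> 'h2::chilbert_space) \<Rightarrow> bool" where
  "phi_map ip \<phi> X \<Phi> \<longleftrightarrow> (\<forall>x\<in>X. \<forall>y\<in>X. cadjoint (\<Phi> x) \<circ> \<Phi> y = \<phi> (ip x y))"

text \<open><Phi_n(x),Phi_n(x)> \<le> phi_n(<x,x>) in M_n(B(H1)) for all x in M_n(X), all n.\<close>
definition completely_semi_phi_map ::
  "('e \<Rightarrow> 'e \<Rightarrow> 'a::cstar_algebra) \<Rightarrow> ('a \<Rightarrow> 'h1::chilbert_space \<Rightarrow> 'h1) \<Rightarrow> 'e set
     \<Rightarrow> ('e \<Rightarrow> 'h1 \<Rightarrow> 'h2::chilbert_space) \<Rightarrow> bool" where
  "completely_semi_phi_map ip \<phi> X \<Phi> \<longleftrightarrow>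
     (\<forall>n (x::nat \<Rightarrow> nat \<Rightarrow> 'e). (\<forall>i<n. \<forall>j<n. x i j \<in> X) \<longrightarrow>
        mpos_op n (\<lambda>i j h. \<phi> (\<Sum>k<n. ip (x k i) (x k j)) h
                          - (\<Sum>k<n. cadjoint (\<Phi> (x k i)) (\<Phi> (x k j) h))))"

end

theory Submission
  imports Defs "HOL-Analysis.Elementary_Normed_Spaces"
begin

text \<open>On formal sums of elementary tensors \<open>x \<otimes> \<xi>\<close> with \<open>x \<in> E\<close>, \<open>\<xi> \<in> H\<^sub>1\<close> put
  \<open>B(x \<otimes> \<xi>, y \<otimes> \<eta>) = \<langle>\<xi>, \<phi>(\<langle>x,y\<rangle>) \<eta>\<rangle>\<close>. A completely semi-\<open>\<phi>\<close>-map on \<open>X\<close> is the same as a contraction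
  \<open>T(x \<otimes> \<xi>) = \<Phi>(x) \<xi>\<close> on the span of the \<open>x \<otimes> \<xi>\<close> with \<open>x \<in> X\<close>, and it is a \<open>\<phi>\<close>-map iff \<open>T\<close> is isometric. Extend
  \<open>T\<close> from \<open>F\<close> to \<open>E\<close> by composing with the orthogonal projection onto the closed span of the \<open>x \<otimes> \<xi>\<close> with
  \<open>x \<in> F\<close>.

  What has to be shown is that \<open>B\<close> is positive on all of \<open>E\<close>, i.e. that \<open>\<phi>\<close> is positive on Gram matrices.
  This is done without square roots in matrix algebras: a Gram-Schmidt step splits off an exact square \<open>b* b\<close> from
  \<open>(a\<^sub>i* \<langle>x\<^sub>i,x\<^sub>j\<rangle> a\<^sub>j)\<close> up to an arbitrarily small error, and an approximate unit removes the \<open>a\<^sub>i\<close>. The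
  last limit uses that \<open>\<phi>\<close> is continuous, which follows from Cohen's factorisation of null sequences.\<close>

section \<open>Approximate units\<close>

lemma scaleC_zero_left [simp]: "0 *\<^sub>C (x::'a::complex_vector) = 0"
  by (metis add_cancel_right_left scaleC_add_left)

lemma scaleC_zero_right [simp]: "c *\<^sub>C (0::'a::complex_vector) = 0"
  by (metis add_cancel_right_left scaleC_add_right)

lemma scaleC_minus_left [simp]: "(- c) *\<^sub>C (x::'a::complex_vector) = - (c *\<^sub>C x)"
  by (metis add.right_inverse eq_neg_iff_add_eq_0 scaleC_add_left scaleC_zero_left add.commute)

lemma scaleC_minus_right [simp]: "c *\<^sub>C (- x) = - (c *\<^sub>C (x::'a::complex_vector))"
  by (metis add.right_inverse eq_neg_iff_add_eq_0 scaleC_add_right scaleC_zero_right add.commute)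

lemma scaleC_diff_left: "(c - d) *\<^sub>C (x::'a::complex_vector) = c *\<^sub>C x - d *\<^sub>C x"
  by (metis diff_conv_add_uminus scaleC_add_left scaleC_minus_left)

lemma scaleC_diff_right: "c *\<^sub>C (x - y) = c *\<^sub>C x - c *\<^sub>C (y::'a::complex_vector)"
  by (metis diff_conv_add_uminus scaleC_add_right scaleC_minus_right)

declare scaleC_one [simp] scaleC_scaleC [simp]

lemmas scaleC_linear =
  scaleC_add_left scaleC_add_right scaleC_diff_left scaleC_diff_right

instance cstar_algebra \<subseteq> banach ..

instance cstar_algebra \<subseteq> real_normed_algebra
proof
  fix a :: real and x y :: "'a"
  show "a *\<^sub>R x * y = a *\<^sub>R (x * y)" "x * a *\<^sub>R y = a *\<^sub>R (x * y)"
    by (simp_all add: scaleR_scaleC mult_scaleC_left mult_scaleC_right)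
  show "norm (x * y) \<le> norm x * norm y" by (rule norm_mult_le)
qed

instance chilbert_space \<subseteq> banach ..

lemma cstar_zero [simp]: "cstar (0::'a::cstar_algebra) = 0"
  by (metis add_cancel_right_left cstar_add)

lemma cstar_minus [simp]: "cstar (- x) = - cstar (x::'a::cstar_algebra)"
  by (metis add.right_inverse eq_neg_iff_add_eq_0 cstar_add cstar_zero add.commute)

lemma cstar_diff: "cstar (x - y) = cstar x - cstar (y::'a::cstar_algebra)"
  by (metis diff_conv_add_uminus cstar_add cstar_minus)

lemma cstar_scaleR: "cstar (r *\<^sub>R x) = r *\<^sub>R cstar (x::'a::cstar_algebra)"
  by (simp add: scaleR_scaleC cstar_scaleC)

declare cstar_cstar [simp]

lemmas cstar_linear = cstar_add cstar_diff cstar_scaleC cstar_scaleR cstar_mult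

lemma norm_cstar [simp]: "norm (cstar x) = norm (x::'a::cstar_algebra)"
proof -
  have "norm x \<le> norm (cstar x)" for x :: 'a
  proof (cases "x = 0")
    case False
    have "(norm x)\<^sup>2 \<le> norm (cstar x) * norm x"
      using norm_mult_le[of "cstar x" x] by (simp add: cstar_identity)
    then show ?thesis using False by (simp add: power2_eq_square)
  qed simp
  from this[of x] this[of "cstar x"] show ?thesis by simp
qed

lemma tendsto_cstar: "X \<longlonglongrightarrow> l \<Longrightarrow> (\<lambda>n. cstar (X n)) \<longlonglongrightarrow> cstar (l::'a::cstar_algebra)"
  by (simp add: LIMSEQ_iff flip: cstar_diff)

lemmas mult_scaleC = mult_scaleC_left mult_scaleC_right

section \<open>Resolvents of hermitian elements\<close>

lemma contraction_fixpoint: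
  fixes f :: "'a::banach \<Rightarrow> 'a"
  assumes "0 \<le> q" "q < 1" "\<And>x y. norm (f x - f y) \<le> q * norm (x - y)"
  shows "\<exists>x. f x = x"
  using banach_fix_type[of q f] assms by (auto simp: dist_norm)

text \<open>Invertibility of \<open>g - i d\<close>: write it as \<open>(g + i t) - i (d + t)\<close>, where by the \<open>C*\<close>-identity
  \<open>g + i t\<close> acts with norm at most \<open>sqrt (\<parallel>g\<parallel>\<^sup>2 + t\<^sup>2) < \<bar>d + t\<bar>\<close> for large \<open>t\<close>.\<close>
lemma hermitian_resolvent:
  fixes g k :: "'a::cstar_algebra"
  assumes g: "cstar g = g" and d: "d \<noteq> 0"
  shows "\<exists>m. g * m - (\<i> * complex_of_real d) *\<^sub>C m = k"
proof -
  \<comment> \<open>The shift satisfies \<open>d * t = (norm g)\<^sup>2\<close>, so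
    \<open>(d + t)\<^sup>2\<close> exceeds \<open>(norm g)\<^sup>2 + t\<^sup>2\<close> by
    \<open>d\<^sup>2 + (norm g)\<^sup>2\<close>.\<close>
  define s where "s = (norm g)\<^sup>2 / d\<^sup>2"
  define t where "t = d * s"
  have s0: "0 \<le> s" by (simp add: s_def)
  define K where "K = sqrt ((norm g)\<^sup>2 + t\<^sup>2)"
  define q where "q = K / \<bar>d + t\<bar>"
  have dt: "d + t = d * (1 + s)" by (simp add: t_def algebra_simps)
  have dt0: "d + t \<noteq> 0" unfolding dt using s0 d by auto
  have "(norm g)\<^sup>2 + t\<^sup>2 < (d + t)\<^sup>2"
  proof -
    have "(norm g)\<^sup>2 = d\<^sup>2 * s" using d by (simp add: s_def)
    moreover have "0 < d\<^sup>2" using d by simp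
    moreover have "0 \<le> d\<^sup>2 * s" using s0 by simp
    ultimately show ?thesis by (simp add: t_def power2_eq_square algebra_simps)
  qed
  then have "K < \<bar>d + t\<bar>"
    unfolding K_def by (metis real_sqrt_abs real_sqrt_less_mono)
  then have q: "0 \<le> q" "q < 1" using dt0 by (auto simp: q_def K_def)
  have op: "norm (g * m + (\<i> * t) *\<^sub>C m) \<le> K * norm m" for m
  proof -
    let ?v = "g * m + (\<i> * t) *\<^sub>C m"
    have c: "cstar ?v = cstar m * g - (\<i> * t) *\<^sub>C cstar m"
      by (simp add: cstar_linear g)
    have "cstar ?v * ?v = cstar m * (g * (g * m)) - ((\<i> * t) * (\<i> * t)) *\<^sub>C (cstar m * m)"
      unfolding c by (simp add: algebra_simps mult_scaleC_left mult_scaleC_right scaleC_linear)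
    also have "(\<i> * t) * (\<i> * t) = - complex_of_real (t\<^sup>2)"
      by (simp add: complex_eq_iff power2_eq_square)
    also have "cstar m * (g * (g * m)) - (- complex_of_real (t\<^sup>2)) *\<^sub>C (cstar m * m) =
        cstar m * (g * (g * m)) + t\<^sup>2 *\<^sub>R (cstar m * m)"
      by (simp add: scaleR_scaleC)
    also have "norm \<dots> \<le> norm (cstar m) * (norm g * (norm g * norm m)) + t\<^sup>2 * (norm (cstar m) * norm m)"
      by (intro norm_triangle_le add_mono)
        (auto intro!: order_trans[OF norm_mult_ineq] mult_mono)
    finally have "(norm ?v)\<^sup>2 \<le> ((norm g)\<^sup>2 + t\<^sup>2) * (norm m)\<^sup>2"
      by (simp only: cstar_identity) (simp add: power2_eq_square algebra_simps)
    then have "norm ?v \<le> sqrt (((norm g)\<^sup>2 + t\<^sup>2) * (norm m)\<^sup>2)"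
      by (rule real_le_rsqrt)
    then show ?thesis by (simp add: K_def real_sqrt_mult)
  qed
  define f where "f m = (- \<i> / (d + t)) *\<^sub>C (g * m + (\<i> * t) *\<^sub>C m - k)" for m
  have "norm (f x - f y) \<le> q * norm (x - y)" for x y
  proof -
    have "f x - f y = (- \<i> / (d + t)) *\<^sub>C (g * (x - y) + (\<i> * t) *\<^sub>C (x - y))"
      by (simp add: f_def algebra_simps scaleC_linear)
    also have "norm \<dots> = norm (g * (x - y) + (\<i> * t) *\<^sub>C (x - y)) / \<bar>d + t\<bar>"
      by (simp only: norm_scaleC norm_divide norm_minus_cancel norm_ii norm_of_real flip: of_real_add) simp
    also have "\<dots> \<le> K * norm (x - y) / \<bar>d + t\<bar>"
      by (intro divide_right_mono op) simp
    finally show ?thesis by (simp add: q_def)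
  qed
  from contraction_fixpoint[OF q this] obtain m where m: "f m = m" by blast
  have "(\<i> * (d + t)) *\<^sub>C m = (\<i> * (d + t)) *\<^sub>C f m" by (simp add: m)
  also have "\<dots> = (\<i> * (d + t) * (- \<i> / (d + t))) *\<^sub>C (g * m + (\<i> * t) *\<^sub>C m - k)"
    by (simp only: f_def scaleC_scaleC)
  also have "\<i> * (d + t) * (- \<i> / (d + t)) = (1::complex)"
    using dt0 by (simp add: field_simps flip: of_real_add)
  finally show ?thesis
    by (intro exI[of _ m]) (simp add: algebra_simps scaleC_linear)
qed

text \<open>This says that multiplication by \<open>1 - w\<close> from either side is a contraction,
  phrased inside the algebra so that no unit has to be adjoined.\<close>

definition near_unit :: "'a::cstar_algebra \<Rightarrow> bool" where
  "near_unit w \<longleftrightarrow> (\<forall>x. norm (x - w * x) \<le> norm x \<and> norm (x - x * w) \<le> norm x)"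

lemma near_unit_cstar:
  assumes "near_unit w" shows "near_unit (cstar w)"
proof -
  have "norm (x - cstar w * x) \<le> norm x" for x
    using assms norm_cstar[of "x - cstar w * x"] unfolding near_unit_def
    by (metis cstar_cstar cstar_diff cstar_mult norm_cstar)
  moreover have "norm (x - x * cstar w) \<le> norm x" for x
    using assms norm_cstar[of "x - x * cstar w"] unfolding near_unit_def
    by (metis cstar_cstar cstar_diff cstar_mult norm_cstar)
  ultimately show ?thesis unfolding near_unit_def by blast
qed

text \<open>\<open>cstar w * w\<close> differs from \<open>cstar w\<close> by at most
  \<open>norm w\<close>, and the C*-identity cancels one factor \<open>norm w\<close>.\<close>

lemma near_unit_norm:
  assumes "near_unit w" shows "norm w \<le> 2"
proof (cases "w = 0")
  case False
  have "norm (cstar w * w) \<le> norm (cstar w) + norm (cstar w - cstar w * w)"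
    by (metis add.commute norm_minus_commute norm_triangle_sub)
  also have "\<dots> \<le> 2 * norm w"
    using assms by (smt (verit) near_unit_def norm_cstar)
  finally show ?thesis using False by (simp add: cstar_identity power2_eq_square)
qed simp

text \<open>\<open>1 - (u + v - u * v) = (1 - u) * (1 - v)\<close> is a product of contractions.
  This is how corrections for different elements are combined.\<close>

lemma near_unit_comp:
  assumes "near_unit u" "near_unit v"
  shows "near_unit (u + v - u * v)"
  unfolding near_unit_def
proof (intro allI conjI)
  fix x
  have "x - (u + v - u * v) * x = (x - v * x) - u * (x - v * x)" by (simp add: algebra_simps)
  then show "norm (x - (u + v - u * v) * x) \<le> norm x"
    using assms by (metis near_unit_def order_trans)
  have "x - x * (u + v - u * v) = (x - x * u) - (x - x * u) * v" by (simp add: algebra_simps)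
  then show "norm (x - x * (u + v - u * v)) \<le> norm x"
    using assms by (metis near_unit_def order_trans)
qed

text \<open>With \<open>w = g (g - i d)\<^sup>-\<^sup>1\<close>, the element \<open>2 w - 1\<close> is the Cayley transform of \<open>g\<close>, hence unitary.\<close>
lemma resolvent_relation:
  fixes g w :: "'a::cstar_algebra"
  assumes g: "cstar g = g" and d: "d \<noteq> 0"
    and w: "g * w - (\<i> * complex_of_real d) *\<^sub>C w = g"
  shows "w + cstar w = cstar w * w + cstar w * w"
proof -
  let ?D = "\<i> * complex_of_real d"
  have e1: "g * w = g + ?D *\<^sub>C w" using w by (simp add: algebra_simps)
  have "cstar (g * w) = cstar (g + ?D *\<^sub>C w)" using e1 by simp
  then have e2: "cstar w * g = g - ?D *\<^sub>C cstar w" by (simp add: cstar_linear g)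
  have "cstar w * (g * w) = (cstar w * g) * w" by (simp add: mult.assoc)
  then have "?D *\<^sub>C (w + cstar w) = ?D *\<^sub>C (cstar w * w + cstar w * w)"
    unfolding e1 e2
    by (simp add: algebra_simps mult_scaleC e1 e2 scaleC_linear)
  then have "(1 / ?D) *\<^sub>C (?D *\<^sub>C (w + cstar w)) = (1 / ?D) *\<^sub>C (?D *\<^sub>C (cstar w * w + cstar w * w))" by (rule arg_cong)
  then show ?thesis using d by simp
qed

text \<open>The hypothesis makes left multiplication by \<open>1 - 2 w\<close> isometric, and
  \<open>x - w * x\<close> is the average of \<open>x\<close> and
  \<open>(1 - 2 w) x\<close>.\<close>

lemma near_unit_left_contraction:
  fixes w :: "'a::cstar_algebra"
  assumes w: "w + cstar w = cstar w * w + cstar w * w"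
  shows "norm (x - w * x) \<le> norm x"
proof -
  let ?y = "x - (w * x + w * x)"
  have "cstar ?y * ?y = cstar x * x + (cstar x * (cstar w * w + cstar w * w) * x - cstar x * (w + cstar w) * x)
      + (cstar x * (cstar w * w + cstar w * w) * x - cstar x * (w + cstar w) * x)"
    by (simp add: cstar_linear algebra_simps)
  also have "\<dots> = cstar x * x" by (simp only: w diff_self add_0_right)
  finally have "(norm ?y)\<^sup>2 = (norm x)\<^sup>2" by (metis cstar_identity)
  then have "norm ?y = norm x" by simp
  moreover have "2 * norm (x - w * x) \<le> norm x + norm ?y"
  proof -
    have "(x - w * x) + (x - w * x) = x + ?y" by (simp add: algebra_simps)
    then have "2 *\<^sub>R (x - w * x) = x + ?y" by (simp add: scaleR_2)
    then have "norm (2 *\<^sub>R (x - w * x)) \<le> norm x + norm ?y"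
      by (metis norm_triangle_ineq)
    then show ?thesis by simp
  qed
  ultimately show ?thesis by simp
qed

lemma near_unit_resolvent:
  fixes g w :: "'a::cstar_algebra"
  assumes g: "cstar g = g" and d: "d \<noteq> 0"
    and w: "g * w - (\<i> * complex_of_real d) *\<^sub>C w = g"
  shows "near_unit w"
proof -
  let ?D = "\<i> * complex_of_real d"
  \<comment> \<open>Evaluating \<open>cstar w * g * v\<close> in two ways identifies
    \<open>v\<close> with \<open>cstar w\<close>. So \<open>cstar w\<close> satisfies the Cayley
    relation too, and the right contraction is the adjoint of the left one for
    \<open>cstar w\<close>.\<close>
  obtain v where v: "g * v - (\<i> * complex_of_real (- d)) *\<^sub>C v = g"
    using hermitian_resolvent[OF g, of "- d" g] d by auto
  have e1: "g * w = g + ?D *\<^sub>C w" using w by (simp add: algebra_simps)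
  have "cstar (g * w) = cstar (g + ?D *\<^sub>C w)" using e1 by simp
  then have e2: "cstar w * g = g - ?D *\<^sub>C cstar w" by (simp add: cstar_linear g)
  have e3: "g * v = g - ?D *\<^sub>C v" using v by (simp add: algebra_simps)
  have "cstar w * (g * v) = (cstar w * g) * v" by (simp add: mult.assoc)
  then have "?D *\<^sub>C cstar w = ?D *\<^sub>C v"
    unfolding e2 e3 by (simp add: algebra_simps mult_scaleC e2 e3)
  then have "(1 / ?D) *\<^sub>C (?D *\<^sub>C cstar w) = (1 / ?D) *\<^sub>C (?D *\<^sub>C v)" by (rule arg_cong)
  then have "v = cstar w" using d by simp
  then have r: "cstar w + w = w * cstar w + w * cstar w"
    using resolvent_relation[OF g _ v] d by simp
  have "norm (x - x * w) \<le> norm x" for x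
  proof -
    have "norm (cstar x - cstar w * cstar x) \<le> norm (cstar x)"
      by (rule near_unit_left_contraction) (use r in simp)
    then show ?thesis by (metis cstar_diff cstar_mult norm_cstar)
  qed
  then show ?thesis
    unfolding near_unit_def using near_unit_left_contraction[OF resolvent_relation[OF g d w]] by blast
qed

text \<open>For \<open>w = g (g - i d)^-1\<close> with \<open>g = cstar b * b\<close>, the square of
  \<open>b - b * w\<close> is \<open>i d (cstar w * w - w)\<close>, of norm at most
  \<open>2 d\<close>; this dictates \<open>d = e\<^sup>2 / 2\<close>.\<close>

lemma right_unit_single:
  fixes b :: "'a::cstar_algebra"
  assumes "0 < e"
  shows "\<exists>w. near_unit w \<and> norm (b - b * w) \<le> e"
proof -
  define d where "d = e\<^sup>2 / 2"
  define g where "g = cstar b * b"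
  have d: "d > 0" using assms by (simp add: d_def)
  have g: "cstar g = g" by (simp add: g_def cstar_linear)
  obtain w where w: "g * w - (\<i> * complex_of_real d) *\<^sub>C w = g"
    using hermitian_resolvent[OF g, of d g] d by auto
  have nu: "near_unit w" using near_unit_resolvent[OF g _ w] d by simp
  have e1: "g * w = g + (\<i> * d) *\<^sub>C w" using w by (simp add: algebra_simps)
  have "cstar (b - b * w) * (b - b * w) = g - g * w - cstar w * (g - g * w)"
    by (simp add: cstar_linear g_def algebra_simps)
  also have "\<dots> = (\<i> * d) *\<^sub>C (cstar w * w - w)"
    unfolding e1 by (simp add: mult_scaleC algebra_simps scaleC_linear)
  also have "norm \<dots> = d * norm (w - cstar w * w)"
    using d by (simp add: norm_scaleC norm_mult norm_minus_commute)
  also have "\<dots> \<le> d * 2"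
    using near_unit_cstar[OF nu] near_unit_norm[OF nu] d
    by (intro mult_left_mono) (auto simp: near_unit_def intro: order_trans)
  finally have "(norm (b - b * w))\<^sup>2 \<le> e\<^sup>2" by (simp add: cstar_identity d_def)
  then show ?thesis using nu assms by (auto dest: power2_le_imp_le)
qed

lemma right_unit_finite:
  fixes S :: "'a::cstar_algebra set"
  assumes "finite S" "0 < e"
  shows "\<exists>w. near_unit w \<and> (\<forall>x\<in>S. norm (x - x * w) \<le> e)"
  using assms(1)
proof induction
  case empty
  have "near_unit 0" by (simp add: near_unit_def)
  then show ?case by auto
next
  case (insert y S)
  then obtain u where u: "near_unit u" "\<forall>x\<in>S. norm (x - x * u) \<le> e" by blast
  \<comment> \<open>\<open>v\<close> is chosen for the remainder \<open>y - y * u\<close>. On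
    \<open>S\<close> the additional right factor \<open>1 - v\<close> does not enlarge the error
    already achieved.\<close>
  obtain v where v: "near_unit v" "norm ((y - y * u) - (y - y * u) * v) \<le> e"
    using right_unit_single assms(2) by blast
  have eq: "x - x * (u + v - u * v) = (x - x * u) - (x - x * u) * v" for x by (simp add: algebra_simps)
  have "\<forall>x\<in>insert y S. norm (x - x * (u + v - u * v)) \<le> e"
    unfolding eq using u v by (auto simp: near_unit_def intro: order_trans)
  then show ?case using near_unit_comp u v by blast
qed

text \<open>In \<open>1 - w = (1 - u) * (1 - cstar v)\<close> the factor next to the element makes
  it small and the other one is a contraction: \<open>u\<close> serves right multiplication on
  \<open>S\<close>, \<open>cstar v\<close> left multiplication on \<open>c\<close>.\<close>

lemma two_sided_unit:
  fixes S :: "'a::cstar_algebra set"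
  assumes "finite S" "0 < e"
  shows "\<exists>w. near_unit w \<and> (\<forall>x\<in>S. norm (x - x * w) \<le> e) \<and> norm (c - w * c) \<le> e"
proof -
  obtain u where u: "near_unit u" "\<forall>x\<in>S. norm (x - x * u) \<le> e"
    using right_unit_finite assms by blast
  obtain v where v: "near_unit v" "norm (cstar c - cstar c * v) \<le> e"
    using right_unit_single assms(2) by blast
  let ?v = "cstar v"
  have v': "near_unit ?v" "norm (c - ?v * c) \<le> e"
    using v near_unit_cstar norm_cstar[of "c - cstar v * c"]
    by (simp_all add: cstar_linear)
  have eq: "x - x * (u + ?v - u * ?v) = (x - x * u) - (x - x * u) * ?v"
    "x - (u + ?v - u * ?v) * x = (x - ?v * x) - u * (x - ?v * x)" for x
    by (simp_all add: algebra_simps)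
  have "(\<forall>x\<in>S. norm (x - x * (u + ?v - u * ?v)) \<le> e) \<and> norm (c - (u + ?v - u * ?v) * c) \<le> e"
    unfolding eq using u v' by (auto simp: near_unit_def intro: order_trans)
  then show ?thesis using near_unit_comp u v' by blast
qed

section \<open>Square roots and Cohen factorisation\<close>

text \<open>\<open>v\<close> is \<open>1 - sqrt (1 - h)\<close>, found as the fixed point of
  \<open>v = (h + v * v) / 2\<close> among hermitian elements of norm at most \<open>norm h\<close>,
  where the map contracts by \<open>norm h < 1\<close>.\<close>

lemma hermitian_sqrt:
  fixes h :: "'a::cstar_algebra"
  assumes h: "cstar h = h" and n: "norm h < 1"
  shows "\<exists>v. cstar v = v \<and> v + v - v * v = h"
proof -
  define S where "S = {v::'a. norm v \<le> norm h \<and> cstar v = v}"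
  define f where "f v = (1/2) *\<^sub>R (h + v * v)" for v
  have "closed S"
    unfolding closed_sequential_limits
  proof (intro allI impI, elim conjE)
    fix X l assume X: "\<forall>n. X n \<in> S" "X \<longlonglongrightarrow> l"
    have "norm l \<le> norm h"
      by (rule LIMSEQ_le_const2[OF tendsto_norm[OF X(2)]]) (use X(1) in \<open>auto simp: S_def\<close>)
    moreover have "(\<lambda>n. cstar (X n)) = X" using X(1) by (auto simp: S_def)
    then have "cstar l = l" using tendsto_cstar[OF X(2)] X(2) LIMSEQ_unique by metis
    ultimately show "l \<in> S" by (simp add: S_def)
  qed
  then have "complete S" by (simp add: complete_eq_closed)
  moreover have "S \<noteq> {}" using h by (auto simp: S_def)
  moreover have "f ` S \<subseteq> S"
  proof
    fix y assume "y \<in> f ` S"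
    then obtain v where v: "norm v \<le> norm h" "cstar v = v" "y = f v" by (auto simp: S_def)
    have "norm (v * v) \<le> norm h * norm h"
      using norm_mult_le[of v v] v(1) by (meson mult_mono norm_ge_zero order_trans)
    also have "\<dots> \<le> norm h" using n by (simp add: mult_left_le)
    finally have "norm (h + v * v) \<le> 2 * norm h" using norm_triangle_ineq[of h "v * v"] by simp
    then show "y \<in> S" using v h by (simp add: S_def f_def cstar_linear)
  qed
  moreover have "\<forall>x\<in>S. \<forall>y\<in>S. dist (f x) (f y) \<le> norm h * dist x y"
  proof (intro ballI)
    fix x y assume "x \<in> S" "y \<in> S"
    then have xy: "norm x \<le> norm h" "norm y \<le> norm h" by (auto simp: S_def)
    have "x * x - y * y = x * (x - y) + (x - y) * y" by (simp add: algebra_simps)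
    also have "norm \<dots> \<le> norm x * norm (x - y) + norm (x - y) * norm y"
      by (intro norm_triangle_le add_mono norm_mult_le)
    also have "\<dots> \<le> norm h * norm (x - y) + norm (x - y) * norm h"
      using xy by (intro add_mono mult_left_mono mult_right_mono) auto
    finally show "dist (f x) (f y) \<le> norm h * dist x y"
      by (simp add: dist_norm f_def flip: scaleR_diff_right)
  qed
  ultimately obtain v where v: "v \<in> S" "f v = v"
    using Banach_fix[of S "norm h" f] n by auto
  have "v + v = 2 *\<^sub>R f v" by (simp add: v scaleR_2)
  then have "v + v - v * v = h" by (simp add: f_def)
  then show ?thesis using v by (auto simp: S_def)
qed

section \<open>Cohen's factorisation of null sequences\<close>

lemma cohen_inverse:
  fixes w :: "'a::cstar_algebra"
  assumes "norm w \<le> 2"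
  shows "\<exists>t. t = (2/9) *\<^sub>R w + (1/3) *\<^sub>R (w * t) \<and> norm t \<le> 4/3"
proof -
  \<comment> \<open>The fixed point equation says that \<open>2/3 + t\<close> is a right inverse of
    \<open>(3 - w) / 2\<close> in the unitisation; \<open>norm w \<le> 2\<close> gives the ratio
    \<open>2/3\<close>.\<close>
  define f where "f t = (2/9) *\<^sub>R w + (1/3) *\<^sub>R (w * t)" for t
  have *: "norm (w * x) \<le> 2 * norm x" for x
    using norm_mult_le[of w x] mult_right_mono[OF assms norm_ge_zero[of x]] by linarith
  have "norm (f x - f y) \<le> 2/3 * norm (x - y)" for x y
  proof -
    have "f x - f y = (1/3) *\<^sub>R (w * (x - y))"
      by (simp add: f_def right_diff_distrib scaleR_diff_right)
    then show ?thesis using *[of "x - y"] by simp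
  qed
  then obtain t where t: "f t = t" using contraction_fixpoint[of "2/3" f] by auto
  have "norm t \<le> norm ((2/9) *\<^sub>R w) + norm ((1/3) *\<^sub>R (w * t))"
    by (subst t[symmetric]) (simp only: f_def norm_triangle_ineq)
  then have "norm t \<le> 4/3" using *[of t] assms by simp
  then show ?thesis using t unfolding f_def by metis
qed

text \<open>One step of Cohen's factorisation in the unitisation: \<open>u'\<close> is \<open>u d\<close> and \<open>c'\<close> is the
  non-scalar part of \<open>d\<^sup>-\<^sup>1 (r + c)\<close>, where \<open>d = (3 - w) / 2\<close> and \<open>d\<^sup>-\<^sup>1 = 2/3 + t\<close>.\<close>
lemma cohen_step:
  fixes u :: "nat \<Rightarrow> 'a::cstar_algebra"
  assumes u: "u \<longlonglongrightarrow> 0" and e: "0 < e" and r: "0 \<le> r"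
  shows "\<exists>u' c'. u' \<longlonglongrightarrow> 0
     \<and> (\<forall>n. (2/3 * r) *\<^sub>R u' n + u' n * c' = r *\<^sub>R u n + u n * c)
     \<and> (\<forall>n. norm (u' n - u n) \<le> e) \<and> norm (c' - c) \<le> 4/3 * r + e"
proof -
  obtain N where N: "\<And>n. n \<ge> N \<Longrightarrow> norm (u n) \<le> e"
    using u e by (metis LIMSEQ_iff diff_zero less_imp_le)
  \<comment> \<open>Only terms before \<open>N\<close> can have norm above \<open>e\<close>.
    \<open>w\<close> is made accurate on these; on the tail the contraction property bounds the
    error by \<open>norm (u n)\<close>.\<close>
  obtain w where w: "near_unit w" "\<forall>x\<in>u ` {..<N}. norm (x - x * w) \<le> e" "norm (c - w * c) \<le> e"
    using two_sided_unit[of "u ` {..<N}" e c] e by auto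
  obtain t where t: "t = (2/9) *\<^sub>R w + (1/3) *\<^sub>R (w * t)" "norm t \<le> 4/3"
    using cohen_inverse near_unit_norm[OF w(1)] by blast
  define u' where "u' n = u n + (1/2) *\<^sub>R (u n - u n * w)" for n
  define c' where "c' = (2/3) *\<^sub>R c + r *\<^sub>R t + t * c"
  have close: "norm (u n - u n * w) \<le> e" for n
    using N[of n] w(1,2) by (cases "n < N") (auto simp: near_unit_def intro: order_trans)
  have "(\<lambda>n. u n + (1/2) *\<^sub>R (u n - u n * w)) \<longlonglongrightarrow> 0 + (1/2) *\<^sub>R (0 - 0 * w)"
    by (intro tendsto_intros u)
  then have "u' \<longlonglongrightarrow> 0" unfolding u'_def by simp
  moreover have "(2/3 * r) *\<^sub>R u' n + u' n * c' = r *\<^sub>R u n + u n * c" for n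
  proof -
    have "w * t = 3 *\<^sub>R t - (2/3) *\<^sub>R w"
      by (subst (2) t(1)) (simp add: scaleR_add_right)
    then have "(u n * w) * t = 3 *\<^sub>R (u n * t) - (2/3) *\<^sub>R (u n * w)"
      by (simp add: mult.assoc right_diff_distrib)
    then have *: "u' n * t = (1/3) *\<^sub>R (u n * w)"
      by (simp add: u'_def distrib_right left_diff_distrib scaleR_diff_right scaleR_add_right)
        (simp flip: scaleR_add_left scaleR_diff_left)
    have "u' n * c' = (2/3) *\<^sub>R (u' n * c) + r *\<^sub>R (u' n * t) + (u' n * t) * c"
      by (simp add: c'_def distrib_left mult.assoc)
    also have "\<dots> = (2/3) *\<^sub>R (u' n * c) + (r/3) *\<^sub>R (u n * w) + (1/3) *\<^sub>R (u n * w * c)"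
      by (simp add: *)
    also have "(2/3) *\<^sub>R (u' n * c) = u n * c - (1/3) *\<^sub>R (u n * w * c)"
      by (simp add: u'_def distrib_right left_diff_distrib scaleR_diff_right scaleR_add_right)
        (simp flip: scaleR_add_left scaleR_diff_left)
    finally have "u' n * c' = u n * c + (r/3) *\<^sub>R (u n * w)" by simp
    moreover have "(2/3 * r) *\<^sub>R u' n = r *\<^sub>R u n - (r/3) *\<^sub>R (u n * w)"
      by (simp add: u'_def scaleR_diff_right scaleR_add_right add_diff_eq flip: scaleR_add_left)
    ultimately show ?thesis by simp
  qed
  moreover have "norm (u' n - u n) \<le> e" for n using close[of n] e by (simp add: u'_def)
  moreover have "norm (c' - c) \<le> 4/3 * r + e"
  proof -
    \<comment> \<open>Where \<open>w\<close> acts as a unit, \<open>t\<close> acts as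
      \<open>1/3\<close>, so \<open>y\<close> is an error term. It satisfies
      \<open>y = (w * y - (c - w * c)) / 3\<close>, and \<open>norm w \<le> 2\<close> yields
      \<open>norm y \<le> e\<close>.\<close>
    define y where "y = t * c - (1/3) *\<^sub>R c"
    have "t * c = (2/9) *\<^sub>R (w * c) + (1/3) *\<^sub>R (w * (t * c))"
      by (subst t(1)) (simp add: distrib_right mult.assoc)
    also have "w * (t * c) = w * y + (1/3) *\<^sub>R (w * c)" by (simp add: y_def right_diff_distrib)
    finally have "t * c = ((2/9) *\<^sub>R (w * c) + (1/9) *\<^sub>R (w * c)) + (1/3) *\<^sub>R (w * y)"
      by (simp add: scaleR_add_right)
    then have "y = (1/3) *\<^sub>R (w * c) - (1/3) *\<^sub>R c + (1/3) *\<^sub>R (w * y)"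
      by (subst y_def) (simp flip: scaleR_add_left)
    then have "y = (1/3) *\<^sub>R (w * y - (c - w * c))"
      by (simp only: scaleR_diff_right) (simp add: algebra_simps)
    then have "norm y = (1/3) * norm (w * y - (c - w * c))"
      by (metis norm_scaleR abs_of_pos zero_less_divide_1_iff zero_less_numeral)
    also have "\<dots> \<le> (1/3) * (2 * norm y + e)"
    proof -
      have "norm (w * y) \<le> 2 * norm y"
        using norm_mult_le[of w y] mult_right_mono[OF near_unit_norm[OF w(1)] norm_ge_zero[of y]] by linarith
      then show ?thesis using norm_triangle_ineq4[of "w * y" "c - w * c"] w(3) by simp
    qed
    finally have "norm y \<le> e" by simp
    moreover have "c' - c = r *\<^sub>R t + y"
    proof -
      have "c = (2/3) *\<^sub>R c + (1/3) *\<^sub>R c" by (simp flip: scaleR_add_left)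
      then show ?thesis unfolding c'_def y_def by (metis (no_types, lifting) add.commute add_diff_cancel_left add_diff_eq diff_diff_add add.assoc)
    qed
    moreover have "norm (r *\<^sub>R t) \<le> r * (4/3)"
      using mult_left_mono[OF t(2) r] r by simp
    ultimately show ?thesis using norm_triangle_ineq[of "r *\<^sub>R t" y] by simp
  qed
  ultimately show ?thesis by blast
qed

lemma geometric_Cauchy:
  fixes X :: "nat \<Rightarrow> 'a::banach"
  assumes q: "0 \<le> q" "q < 1" and X: "\<And>n. norm (X (Suc n) - X n) \<le> K * q ^ n"
  shows "\<exists>l. X \<longlonglongrightarrow> l \<and> (\<forall>n. norm (l - X n) \<le> K * q ^ n / (1 - q))"
proof -
  have s: "summable (\<lambda>n. K * q ^ n)" using q by (intro summable_mult summable_geometric) simp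
  have s': "summable (\<lambda>n. norm (X (Suc (n + k)) - X (n + k)))" for k
  proof (rule summable_comparison_test')
    show "summable (\<lambda>n. K * q ^ (n + k))" by (rule summable_ignore_initial_segment[OF s])
    show "norm (norm (X (Suc (n + k)) - X (n + k))) \<le> K * q ^ (n + k)" for n
      using X[of "n + k"] by simp
  qed
  have "summable (\<lambda>n. X (Suc n) - X n)" using s'[of 0] by (auto intro: summable_norm_cancel)
  then have "(\<lambda>n. \<Sum>i<n. X (Suc i) - X i) \<longlonglongrightarrow> (\<Sum>i. X (Suc i) - X i)" by (rule summable_LIMSEQ)
  then have "(\<lambda>n. X n - X 0) \<longlonglongrightarrow> (\<Sum>i. X (Suc i) - X i)"
    by (simp add: sum_lessThan_telescope)
  then have l: "X \<longlonglongrightarrow> (\<Sum>i. X (Suc i) - X i) + X 0" (is "_ \<longlonglongrightarrow> ?l")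
    using tendsto_add[OF _ tendsto_const[of "X 0"]] by fastforce
  have "norm (?l - X k) \<le> K * q ^ k / (1 - q)" for k
  proof (rule LIMSEQ_le_const2)
    show "(\<lambda>n. norm (X (n + k) - X k)) \<longlonglongrightarrow> norm (?l - X k)"
      by (intro tendsto_intros LIMSEQ_ignore_initial_segment l)
    have "norm (X (n + k) - X k) \<le> K * q ^ k / (1 - q)" for n
    proof -
      have "X (n + k) - X k = (\<Sum>i<n. X (Suc (i + k)) - X (i + k))"
        using sum_lessThan_telescope[of "\<lambda>i. X (i + k)" n] by simp
      also have "norm \<dots> \<le> (\<Sum>i<n. K * q ^ (i + k))" by (intro sum_norm_le) (use X in auto)
      also have "\<dots> = K * q ^ k * (\<Sum>i<n. q ^ i)" by (simp add: sum_distrib_left power_add algebra_simps)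
      also have "\<dots> \<le> K * q ^ k * (1 / (1 - q))"
      proof (rule mult_left_mono)
        have "(\<Sum>i<n. q ^ i) = (1 - q ^ n) / (1 - q)" using q sum_gp_strict[of q n] by simp
        also have "\<dots> \<le> 1 / (1 - q)" using q by (intro divide_right_mono) auto
        finally show "(\<Sum>i<n. q ^ i) \<le> 1 / (1 - q)" .
        show "0 \<le> K * q ^ k" using X[of k] norm_ge_zero order_trans by blast
      qed
      finally show ?thesis by simp
    qed
    then show "\<exists>N. \<forall>n\<ge>N. norm (X (n + k) - X k) \<le> K * q ^ k / (1 - q)" by blast
  qed
  then show ?thesis using l by blast
qed

lemma inverse_Suc_Cauchy:
  fixes X :: "nat \<Rightarrow> 'a::banach"
  assumes "\<And>i j. norm (X i - X j) \<le> inverse (real (Suc i)) + inverse (real (Suc j))"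
  shows "\<exists>l. X \<longlonglongrightarrow> l"
proof -
  have "Cauchy X"
  proof (rule CauchyI)
    fix e :: real assume "0 < e"
    then obtain N where N: "inverse (real (Suc N)) < e / 2" using reals_Archimedean[of "e/2"] by auto
    have "norm (X i - X j) < e" if "i \<ge> N" "j \<ge> N" for i j
    proof -
      have "inverse (real (Suc i)) \<le> inverse (real (Suc N))" "inverse (real (Suc j)) \<le> inverse (real (Suc N))"
        using that by auto
      then show ?thesis using assms[of i j] N by linarith
    qed
    then show "\<exists>M. \<forall>i\<ge>M. \<forall>j\<ge>M. norm (X i - X j) < e" by blast
  qed
  then show ?thesis using Cauchy_convergent convergent_def by blast
qed

text \<open>Iterating the step preserves \<open>a n = r u n + u n c\<close> while the scalar
  \<open>r = (2/3)^m\<close> tends to 0. Both \<open>u\<close> and \<open>c\<close> converge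
  geometrically, and only the product survives in the limit.\<close>

theorem cohen_factorization:
  fixes a :: "nat \<Rightarrow> 'a::cstar_algebra"
  assumes a: "a \<longlonglongrightarrow> 0"
  shows "\<exists>u c. u \<longlonglongrightarrow> 0 \<and> (\<forall>n. a n = u n * c)"
proof -
  let ?P = "\<lambda>m (u, c). u \<longlonglongrightarrow> 0 \<and> (\<forall>n. (2/3)^m *\<^sub>R u n + u n * c = a n)"
  let ?Q = "\<lambda>m (u, c) (u', c'). (\<forall>n. norm (u' n - u n) \<le> (2/3)^m)
    \<and> norm (c' - c) \<le> 4/3 * (2/3)^m + (2/3)^m"
  have "\<exists>f. \<forall>m. ?P m (f m) \<and> ?Q m (f m) (f (Suc m))"
  proof (rule dependent_nat_choice)
    show "\<exists>s. ?P 0 s" using a by (intro exI[of _ "(a, 0)"]) simp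
  next
    fix s m assume P: "?P m s"
    obtain u c where s: "s = (u, c)" by (cases s)
    obtain u' c' where "u' \<longlonglongrightarrow> 0"
      "\<forall>n. (2/3 * (2/3)^m) *\<^sub>R u' n + u' n * c' = (2/3)^m *\<^sub>R u n + u n * c"
      "\<forall>n. norm (u' n - u n) \<le> (2/3)^m" "norm (c' - c) \<le> 4/3 * (2/3)^m + (2/3)^m"
      using cohen_step[of u "(2/3)^m" "(2/3)^m" c] P s by auto
    then show "\<exists>s'. ?P (Suc m) s' \<and> ?Q m s s'"
      using P s by (intro exI[of _ "(u', c')"]) auto
  qed
  then obtain f where f: "\<And>m. ?P m (f m) \<and> ?Q m (f m) (f (Suc m))" by blast
  define u where "u m = fst (f m)" for m
  define c where "c m = snd (f m)" for m
  have fm: "f m = (u m, c m)" for m by (simp add: u_def c_def)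
  have P: "u m \<longlonglongrightarrow> 0" "(2/3)^m *\<^sub>R u m n + u m n * c m = a n" for m n
    using f[of m] by (auto simp: fm)
  have Q: "norm (u (Suc m) n - u m n) \<le> 1 * (2/3)^m" "norm (c (Suc m) - c m) \<le> (7/3) * (2/3)^m" for m n
    using f[of m] by (auto simp: fm)
  have "\<exists>l. (\<lambda>m. u m n) \<longlonglongrightarrow> l \<and> (\<forall>m. norm (l - u m n) \<le> 3 * (2/3)^m)" for n
    using geometric_Cauchy[of "2/3" "\<lambda>m. u m n" 1] Q(1)[of _ n] by (simp add: mult.commute)
  then obtain v where v: "\<And>n. (\<lambda>m. u m n) \<longlonglongrightarrow> v n" "\<And>n m. norm (v n - u m n) \<le> 3 * (2/3)^m"
    by metis
  obtain d where d: "c \<longlonglongrightarrow> d" using geometric_Cauchy[of "2/3" c "7/3"] Q(2) by auto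
  have "a n = v n * d" for n
  proof -
    have "(\<lambda>m. (2/3)^m *\<^sub>R u m n + u m n * c m) \<longlonglongrightarrow> 0 *\<^sub>R v n + v n * d"
      by (intro tendsto_intros v d LIMSEQ_power_zero) simp
    then show ?thesis by (simp add: P(2) LIMSEQ_const_iff)
  qed
  \<comment> \<open>The estimate \<open>v(2)\<close> is uniform in \<open>n\<close>, so the limit
    over \<open>m\<close> of null sequences is again a null sequence.\<close>
  moreover have "v \<longlonglongrightarrow> 0"
  proof (rule LIMSEQ_I)
    fix e :: real assume e: "0 < e"
    obtain m where m: "(2/3::real)^m < e / 6"
      using real_arch_pow_inv[of "e/6" "2/3"] e by auto
    obtain N where N: "\<And>n. n \<ge> N \<Longrightarrow> norm (u m n) < e / 2"
      using P(1)[of m] e by (metis LIMSEQ_iff diff_zero half_gt_zero)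
    have "norm (v n - 0) < e" if "n \<ge> N" for n
      using v(2)[of n m] m N[OF that] norm_triangle_sub[of "v n" "u m n"] by simp
    then show "\<exists>N. \<forall>n\<ge>N. norm (v n - 0) < e" by blast
  qed
  ultimately show ?thesis by blast
qed

text \<open>The remaining null sequence is factored once more through its adjoints. The resulting
  form is the one to which Cauchy-Schwarz for \<open>\<phi>\<close> applies.\<close>

corollary cohen_factorization_two_sided:
  fixes a :: "nat \<Rightarrow> 'a::cstar_algebra"
  assumes a: "a \<longlonglongrightarrow> 0"
  shows "\<exists>v c d. v \<longlonglongrightarrow> 0 \<and> (\<forall>n. a n = cstar c * (v n * d))"
proof -
  obtain u d where u: "u \<longlonglongrightarrow> 0" "\<And>n. a n = u n * d" using cohen_factorization[OF a] by blast
  have "(\<lambda>n. cstar (u n)) \<longlonglongrightarrow> 0" using tendsto_cstar[OF u(1)] by simp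
  then obtain v c where v: "v \<longlonglongrightarrow> 0" "\<And>n. cstar (u n) = v n * c"
    using cohen_factorization by meson
  have "u n = cstar c * cstar (v n)" for n by (metis v(2) cstar_cstar cstar_mult)
  then have "a n = cstar c * (cstar (v n) * d)" for n by (simp add: u(2) mult.assoc)
  moreover have "(\<lambda>n. cstar (v n)) \<longlonglongrightarrow> 0" using tendsto_cstar[OF v(1)] by simp
  ultimately show ?thesis by blast
qed

section \<open>Semi-inner products, Riesz representation and adjoints\<close>

lemma cinner_add_left: "cinner (x + y) z = cinner x z + cinner y (z::'a::chilbert_space)"
  by (metis cinner_add_right cinner_commute complex_cnj_add)

lemma cinner_scaleC_left: "cinner (c *\<^sub>C x) y = cnj c * cinner x (y::'a::chilbert_space)"
  by (metis cinner_commute cinner_scaleC_right complex_cnj_mult)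

lemma cinner_zero_right [simp]: "cinner x (0::'a::chilbert_space) = 0"
  by (metis add_cancel_right_left cinner_add_right)

lemma cinner_zero_left [simp]: "cinner (0::'a::chilbert_space) x = 0"
  by (metis add_cancel_right_left cinner_add_left)

lemma cinner_minus_right [simp]: "cinner x (- y) = - cinner x (y::'a::chilbert_space)"
  using cinner_add_right[of x y "- y"] by (simp add: eq_neg_iff_add_eq_0 add.commute)

lemma cinner_minus_left [simp]: "cinner (- x) y = - cinner x (y::'a::chilbert_space)"
  using cinner_add_left[of x "- x" y] by (simp add: eq_neg_iff_add_eq_0 add.commute)

lemma cinner_diff_right: "cinner x (y - z) = cinner x y - cinner x (z::'a::chilbert_space)"
  by (metis cinner_add_right cinner_minus_right diff_conv_add_uminus)

lemma cinner_diff_left: "cinner (x - y) z = cinner x z - cinner y (z::'a::chilbert_space)"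
  by (metis cinner_add_left cinner_minus_left diff_conv_add_uminus)

lemma cinner_sum_right: "cinner x (\<Sum>i\<in>I. f i) = (\<Sum>i\<in>I. cinner x (f i :: 'a::chilbert_space))"
  by (induction I rule: infinite_finite_induct) (auto simp: cinner_add_right)

lemma cinner_sum_left: "cinner (\<Sum>i\<in>I. f i) x = (\<Sum>i\<in>I. cinner (f i :: 'a::chilbert_space) x)"
  by (induction I rule: infinite_finite_induct) (auto simp: cinner_add_left)

lemma cinner_sum_list_right: "cinner x (sum_list l) = (\<Sum>y\<leftarrow>l. cinner x (y :: 'a::chilbert_space))"
  by (induction l) (auto simp: cinner_add_right)

lemma cinner_sum_list_left: "cinner (sum_list l) x = (\<Sum>y\<leftarrow>l. cinner (y :: 'a::chilbert_space) x)"
  by (induction l) (auto simp: cinner_add_left)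

lemma cinner_ext:
  fixes x y :: "'a::chilbert_space"
  assumes "\<And>z. cinner z x = cinner z y" shows "x = y"
proof -
  have "cinner (x - y) (x - y) = 0" using assms by (simp add: cinner_diff_right)
  then show ?thesis by (simp add: cinner_norm)
qed

text \<open>Discriminant argument in which \<open>\<beta>\<close> is the squared modulus of a mixed
  term: evaluate at the minimum \<open>t = 1 / \<gamma>\<close>; if \<open>\<gamma> = 0\<close>, a
  large \<open>t\<close> forces \<open>\<beta> = 0\<close>.\<close>

lemma quadratic_bound:
  fixes \<alpha> \<beta> \<gamma> :: real
  assumes "0 \<le> \<alpha>" "0 \<le> \<beta>" "0 \<le> \<gamma>" and q: "\<And>t. 0 \<le> \<alpha> - 2 * t * \<beta> + t\<^sup>2 * \<beta> * \<gamma>"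
  shows "\<beta> \<le> \<alpha> * \<gamma>"
proof (cases "\<gamma> = 0")
  case True
  have "\<beta> = 0"
  proof (rule ccontr)
    assume "\<beta> \<noteq> 0"
    then show False using q[of "(\<alpha> + 1) / (2 * \<beta>)"] True by simp
  qed
  then show ?thesis using True by simp
next
  case False
  then have g: "0 < \<gamma>" using assms by simp
  have "0 \<le> \<alpha> - \<beta> / \<gamma>" using q[of "1 / \<gamma>"] False by (simp add: power2_eq_square field_simps)
  then show ?thesis using g by (simp add: field_simps)
qed

text \<open>The carrier is only required to have an addition and a scalar multiplication, with no laws: this
  covers lists with concatenation, which stand for formal sums of elementary tensors.\<close>
locale semi_inner =
  fixes plus :: "'v \<Rightarrow> 'v \<Rightarrow> 'v" and smul :: "complex \<Rightarrow> 'v \<Rightarrow> 'v" and B :: "'v \<Rightarrow> 'v \<Rightarrow> complex"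
  assumes add_left: "B (plus u v) w = B u w + B v w"
    and add_right: "B u (plus v w) = B u v + B u w"
    and smul_left: "B (smul c u) v = cnj c * B u v"
    and smul_right: "B u (smul c v) = c * B u v"
    and real: "Im (B u u) = 0"
    and pos: "0 \<le> Re (B u u)"
begin

abbreviation Q :: "'v \<Rightarrow> real" where "Q u \<equiv> Re (B u u)"

lemma hermitian: "B u v = cnj (B v u)"
proof -
  have "Im (B u v) + Im (B v u) = 0"
    using real[of "plus u v"] real[of u] real[of v] by (simp add: add_left add_right)
  moreover have "Re (B u v) - Re (B v u) = 0"
    using real[of "plus u (smul \<i> v)"] real[of u] real[of v]
    by (simp add: add_left add_right smul_left smul_right)
  ultimately show ?thesis by (simp add: complex_eq_iff)
qed

lemma self_eq: "B u u = complex_of_real (Q u)"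
  using real[of u] by (simp add: complex_eq_iff)

lemma Q_plus_smul: "Q (plus u (smul c v)) = Q u + 2 * Re (c * B u v) + (cmod c)\<^sup>2 * Q v"
proof -
  have "Re (cnj c * B v u) = Re (c * B u v)"
    by (subst hermitian) simp
  moreover have "Re (c * (cnj c * B v v)) = (cmod c)\<^sup>2 * Q v"
    by (subst self_eq) (simp add: cmod_power2, simp add: power2_eq_square algebra_simps)
  ultimately show ?thesis by (simp add: add_left add_right smul_left smul_right algebra_simps)
qed

lemma cauchy_schwarz: "(cmod (B u v))\<^sup>2 \<le> Q u * Q v"
proof (rule quadratic_bound)
  fix t :: real
  \<comment> \<open>The conjugate phase turns the mixed term into \<open>- t\<close> times its
    squared modulus.\<close>
  let ?c = "- t * cnj (B u v)"
  have "0 \<le> Q (plus u (smul ?c v))" by (rule pos)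
  also have "\<dots> = Q u + 2 * Re (?c * B u v) + (cmod ?c)\<^sup>2 * Q v" by (rule Q_plus_smul)
  also have "Re (?c * B u v) = - t * (cmod (B u v))\<^sup>2"
    by (simp add: cmod_power2) (simp add: power2_eq_square algebra_simps)
  also have "(cmod ?c)\<^sup>2 = t\<^sup>2 * (cmod (B u v))\<^sup>2"
    by (simp only: norm_mult complex_mod_cnj power_mult_distrib norm_minus_cancel norm_of_real power2_abs power2_minus)
  finally show "0 \<le> Q u - 2 * t * (cmod (B u v))\<^sup>2 + t\<^sup>2 * (cmod (B u v))\<^sup>2 * Q v" by simp
qed (auto simp: pos)

text \<open>\<open>m\<close> is a near-minimiser of \<open>Q u - 2 Re (L u)\<close> on
  \<open>M\<close>: moving \<open>m\<close> along \<open>u\<close> lowers this by less than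
  \<open>e\<^sup>2\<close>, which bounds the mixed term. The infimum need not be attained, hence the
  error \<open>e\<close>.\<close>

lemma approx_riesz:
  fixes L :: "'v \<Rightarrow> complex"
  assumes M: "M \<noteq> {}" "\<And>u v. u \<in> M \<Longrightarrow> v \<in> M \<Longrightarrow> plus u v \<in> M" "\<And>c u. u \<in> M \<Longrightarrow> smul c u \<in> M"
    and L: "\<And>u v. L (plus u v) = L u + L v" "\<And>c u. L (smul c u) = c * L u"
    and C: "0 \<le> C" "\<And>u. u \<in> M \<Longrightarrow> (cmod (L u))\<^sup>2 \<le> C * Q u"
    and e: "0 < e"
  shows "\<exists>m\<in>M. \<forall>u\<in>M. cmod (L u - B m u) \<le> e * sqrt (Q u)"
proof -
  define J where "J u = Q u - 2 * Re (L u)" for u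
  have J: "- C \<le> J u" if "u \<in> M" for u
  proof -
    have "cmod (L u) \<le> sqrt C * sqrt (Q u)"
      using real_le_rsqrt[OF C(2)[OF that]] by (simp add: real_sqrt_mult)
    then have "Re (L u) \<le> sqrt C * sqrt (Q u)" using complex_Re_le_cmod order_trans by blast
    moreover have "0 \<le> (sqrt C - sqrt (Q u))\<^sup>2" by simp
    ultimately show ?thesis using C(1) pos[of u] by (simp add: J_def power2_diff)
  qed
  then have bdd: "bdd_below (J ` M)" by (auto intro!: bdd_belowI)
  define I where "I = Inf (J ` M)"
  have "\<exists>y\<in>J ` M. y < I + e\<^sup>2" using bdd M(1) e by (subst cInf_less_iff[symmetric]) (auto simp: I_def)
  then obtain m where m: "m \<in> M" "J m < I + e\<^sup>2" by blast
  have "cmod (L u - B m u) \<le> e * sqrt (Q u)" if u: "u \<in> M" for u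
  proof -
    let ?d = "B m u - L u"
    have "(cmod ?d)\<^sup>2 \<le> e\<^sup>2 * Q u"
    proof (rule quadratic_bound)
      fix t :: real
      let ?c = "- t * cnj ?d"
      have "I \<le> J (plus m (smul ?c u))"
        unfolding I_def by (rule cInf_lower[OF _ bdd]) (use M m u in auto)
      also have "\<dots> = J m + 2 * Re (?c * ?d) + (cmod ?c)\<^sup>2 * Q u"
        unfolding J_def Q_plus_smul L by (simp add: algebra_simps)
      also have "Re (?c * ?d) = - t * (cmod ?d)\<^sup>2"
        by (simp add: cmod_power2) (simp add: power2_eq_square algebra_simps)
      also have "(cmod ?c)\<^sup>2 = t\<^sup>2 * (cmod ?d)\<^sup>2"
        by (simp only: norm_mult complex_mod_cnj power_mult_distrib norm_minus_cancel norm_of_real power2_abs power2_minus)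
      finally show "0 \<le> e\<^sup>2 - 2 * t * (cmod ?d)\<^sup>2 + t\<^sup>2 * (cmod ?d)\<^sup>2 * Q u" using m(2) by simp
    qed (auto simp: pos)
    then have "cmod ?d \<le> sqrt (e\<^sup>2 * Q u)" by (rule real_le_rsqrt)
    then show ?thesis using e by (simp add: real_sqrt_mult norm_minus_commute)
  qed
  then show ?thesis using m(1) by blast
qed

end

interpretation hilbert: semi_inner "(+)" scaleC "cinner :: 'a::chilbert_space \<Rightarrow> 'a \<Rightarrow> complex"
  by unfold_locales
    (simp_all add: cinner_add_left cinner_add_right cinner_scaleC_left cinner_scaleC_right cinner_norm)

lemma cinner_cauchy_schwarz: "cmod (cinner x y) \<le> norm x * norm (y::'a::chilbert_space)"
proof -
  have "(cmod (cinner x y))\<^sup>2 \<le> (norm x * norm y)\<^sup>2"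
    using hilbert.cauchy_schwarz[of x y] by (simp add: cinner_norm power_mult_distrib)
  then show ?thesis by (rule power2_le_imp_le) simp
qed

lemma tendsto_cinner_left:
  fixes l :: "'a::chilbert_space"
  assumes "X \<longlonglongrightarrow> l" shows "(\<lambda>n. cinner (X n) y) \<longlonglongrightarrow> cinner l y"
proof (rule Lim_null_comparison[THEN LIM_zero_cancel])
  show "\<forall>\<^sub>F n in sequentially. norm (cinner (X n) y - cinner l y) \<le> norm (X n - l) * norm y"
    using cinner_cauchy_schwarz[of "X _ - l" y] by (simp add: cinner_diff_left)
  show "(\<lambda>n. norm (X n - l) * norm y) \<longlonglongrightarrow> 0"
    using assms by (intro tendsto_mult_left_zero tendsto_norm_zero) (simp add: LIM_zero)
qed

text \<open>Two approximate representers, tested on their own difference, are as close as the sum of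
  their errors; completeness supplies the limit.\<close>

theorem riesz_representation:
  fixes L :: "'a::chilbert_space \<Rightarrow> complex"
  assumes add: "\<And>u v. L (u + v) = L u + L v" and scale: "\<And>c u. L (c *\<^sub>C u) = c * L u"
    and bound: "\<And>u. cmod (L u) \<le> K * norm u"
  shows "\<exists>s. \<forall>u. L u = cinner s u"
proof -
  have K: "(cmod (L u))\<^sup>2 \<le> K\<^sup>2 * (norm u)\<^sup>2" for u
    using power_mono[OF bound[of u], of 2] by (simp add: power_mult_distrib)
  have "\<exists>m. \<forall>u. cmod (L u - cinner m u) \<le> inverse (real (Suc n)) * norm u" for n
    using hilbert.approx_riesz[of UNIV L "K\<^sup>2" "inverse (real (Suc n))"] K add scale
    by (simp add: cinner_norm)
  then obtain m where m: "\<And>n u. cmod (L u - cinner (m n) u) \<le> inverse (real (Suc n)) * norm u"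
    by metis
  have "norm (m i - m j) \<le> inverse (real (Suc i)) + inverse (real (Suc j))" for i j
  proof -
    let ?d = "m i - m j"
    have "(norm ?d)\<^sup>2 = cmod (cinner ?d ?d)" by (simp only: cinner_norm norm_of_real) simp
    also have "cinner ?d ?d = (L ?d - cinner (m j) ?d) - (L ?d - cinner (m i) ?d)"
      by (simp add: cinner_diff_left)
    also have "cmod \<dots> \<le> inverse (real (Suc j)) * norm ?d + inverse (real (Suc i)) * norm ?d"
      by (intro order_trans[OF norm_triangle_ineq4] add_mono m)
    finally show ?thesis by (cases "?d = 0") (simp_all add: power2_eq_square flip: distrib_right)
  qed
  then obtain s where s: "m \<longlonglongrightarrow> s" using inverse_Suc_Cauchy by blast
  have "L u = cinner s u" for u
  proof -
    have "(\<lambda>n. L u - cinner (m n) u) \<longlonglongrightarrow> 0"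
    proof (rule Lim_null_comparison)
      show "\<forall>\<^sub>F n in sequentially. norm (L u - cinner (m n) u) \<le> inverse (real (Suc n)) * norm u"
        using m by simp
      show "(\<lambda>n. inverse (real (Suc n)) * norm u) \<longlonglongrightarrow> 0"
        by (intro tendsto_mult_left_zero LIMSEQ_inverse_real_of_nat)
    qed
    moreover have "(\<lambda>n. L u - cinner (m n) u) \<longlonglongrightarrow> L u - cinner s u"
      by (intro tendsto_intros tendsto_cinner_left s)
    ultimately show ?thesis using LIMSEQ_unique by fastforce
  qed
  then show ?thesis by blast
qed

text \<open>Riesz gives existence and nondegeneracy gives uniqueness, so the \<open>THE\<close> in
  \<open>cadjoint\<close> denotes the adjoint.\<close>

theorem cinner_cadjoint:
  fixes T :: "'a::chilbert_space \<Rightarrow> 'b::chilbert_space"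
  assumes T: "bounded_clinear T"
  shows "cinner (cadjoint T y) x = cinner y (T x)" "cinner x (cadjoint T y) = cinner (T x) y"
proof -
  obtain K where K: "\<And>x. norm (T x) \<le> norm x * K" using T unfolding bounded_clinear_def by blast
  have "\<exists>s. \<forall>x. cinner y (T x) = cinner s x" for y
  proof (rule riesz_representation)
    show "cmod (cinner y (T u)) \<le> (norm y * K) * norm u" for u
      using cinner_cauchy_schwarz[of y "T u"] mult_left_mono[OF K[of u] norm_ge_zero[of y]]
      by (simp add: algebra_simps)
  qed (use T in \<open>simp_all add: bounded_clinear_def cinner_add_right cinner_scaleC_right\<close>)
  then obtain S where S: "\<forall>x y. cinner (S y) x = cinner y (T x)" by metis
  have "cadjoint T = S"
    unfolding cadjoint_def
  proof (rule the_equality)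
    fix S' assume S': "\<forall>x y. cinner (S' y) x = cinner y (T x)"
    have "S' y = S y" for y by (rule cinner_ext) (metis S S' cinner_commute)
    then show "S' = S" by blast
  qed (rule S)
  then show *: "cinner (cadjoint T y) x = cinner y (T x)" for x y using S by simp
  show "cinner x (cadjoint T y) = cinner (T x) y" by (metis * cinner_commute)
qed

section \<open>Formal sums of elementary tensors\<close>

definition lsmul :: "complex \<Rightarrow> ('i \<times> 'h::complex_vector) list \<Rightarrow> ('i \<times> 'h) list" where
  "lsmul c l = map (\<lambda>(x, \<xi>). (x, c *\<^sub>C \<xi>)) l"

text \<open>The sesquilinear extension of an operator-valued kernel to formal sums; an entry
  \<open>(x, \<xi>)\<close> stands for an elementary tensor.\<close>

definition kform :: "('i \<Rightarrow> 'i \<Rightarrow> 'h::chilbert_space \<Rightarrow> 'h) \<Rightarrow> ('i \<times> 'h) list \<Rightarrow> ('i \<times> 'h) list \<Rightarrow> complex" where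
  "kform \<kappa> l l' = (\<Sum>(x, \<xi>)\<leftarrow>l. \<Sum>(y, \<eta>)\<leftarrow>l'. cinner \<xi> (\<kappa> x y \<eta>))"

lemma kform_single [simp]: "kform \<kappa> [(x, \<xi>)] [(y, \<eta>)] = cinner \<xi> (\<kappa> x y \<eta>)"
  by (simp add: kform_def)

lemma kform_map_upt:
  "kform \<kappa> (map (\<lambda>i. (x i, \<xi> i)) [0..<n]) (map (\<lambda>i. (x i, \<xi> i)) [0..<n]) =
    (\<Sum>i<n. \<Sum>j<n. cinner (\<xi> i) (\<kappa> (x i) (x j) (\<xi> j)))"
  by (simp add: kform_def comp_def interv_sum_list_conv_sum_set_nat atLeast0LessThan)

lemma semi_inner_kform:
  fixes \<kappa> :: "'i \<Rightarrow> 'i \<Rightarrow> 'h::chilbert_space \<Rightarrow> 'h"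
  assumes lin: "\<And>x y \<xi> \<eta>. \<kappa> x y (\<xi> + \<eta>) = \<kappa> x y \<xi> + \<kappa> x y \<eta>" "\<And>x y c \<xi>. \<kappa> x y (c *\<^sub>C \<xi>) = c *\<^sub>C \<kappa> x y \<xi>"
    and pos: "\<And>(n::nat) x \<xi>. Im (\<Sum>i<n. \<Sum>j<n. cinner (\<xi> i) (\<kappa> (x i) (x j) (\<xi> j))) = 0"
      "\<And>(n::nat) x \<xi>. 0 \<le> Re (\<Sum>i<n. \<Sum>j<n. cinner (\<xi> i) (\<kappa> (x i) (x j) (\<xi> j)))"
  shows "semi_inner (@) lsmul (kform \<kappa>)"
proof
  fix u v w :: "('i \<times> 'h) list" and c
  show "kform \<kappa> (u @ v) w = kform \<kappa> u w + kform \<kappa> v w" by (simp add: kform_def)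
  show "kform \<kappa> u (v @ w) = kform \<kappa> u v + kform \<kappa> u w"
    by (simp add: kform_def case_prod_unfold sum_list_addf)
  show "kform \<kappa> (lsmul c u) v = cnj c * kform \<kappa> u v"
    by (simp add: kform_def lsmul_def case_prod_unfold comp_def cinner_scaleC_left sum_list_const_mult)
  show "kform \<kappa> u (lsmul c v) = c * kform \<kappa> u v"
    by (simp add: kform_def lsmul_def case_prod_unfold comp_def lin cinner_scaleC_right sum_list_const_mult)
  have u: "map (\<lambda>i. (fst (u ! i), snd (u ! i))) [0..<length u] = u" by (simp add: map_nth)
  have "kform \<kappa> u u = (\<Sum>i<length u. \<Sum>j<length u.
      cinner (snd (u ! i)) (\<kappa> (fst (u ! i)) (fst (u ! j)) (snd (u ! j))))"
    using kform_map_upt[of \<kappa> "\<lambda>i. fst (u ! i)" "\<lambda>i. snd (u ! i)" "length u"] unfolding u .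
  then show "Im (kform \<kappa> u u) = 0" "0 \<le> Re (kform \<kappa> u u)" by (simp_all only: pos)
qed

section \<open>Positivity of completely positive maps on Gram matrices\<close>

locale cp_map =
  fixes \<phi> :: "'a::cstar_algebra \<Rightarrow> 'h::chilbert_space \<Rightarrow> 'h"
  assumes cp: "completely_positive \<phi>"
begin

lemma phi_add: "\<phi> (a + b) h = \<phi> a h + \<phi> b h"
  and phi_scaleC: "\<phi> (c *\<^sub>C a) h = c *\<^sub>C \<phi> a h"
  and phi_bounded: "bounded_clinear (\<phi> a)"
  and phi_add_arg: "\<phi> a (h + k) = \<phi> a h + \<phi> a k"
  and phi_scaleC_arg: "\<phi> a (c *\<^sub>C h) = c *\<^sub>C \<phi> a h"
  using cp unfolding completely_positive_def bounded_clinear_def by metis+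

lemma phi_zero [simp]: "\<phi> 0 h = 0"
  by (metis add_cancel_right_left phi_add)

lemma phi_minus [simp]: "\<phi> (- a) h = - \<phi> a h"
  using phi_add[of a "- a" h] by (simp add: eq_neg_iff_add_eq_0 add.commute)

lemma phi_diff: "\<phi> (a - b) h = \<phi> a h - \<phi> b h"
  by (metis diff_conv_add_uminus phi_add phi_minus)

lemma phi_sum: "\<phi> (\<Sum>i\<in>I. f i) h = (\<Sum>i\<in>I. \<phi> (f i) h)"
  by (induction I rule: infinite_finite_induct) (auto simp: phi_add)

sublocale alg: semi_inner "(@)" lsmul "kform (\<lambda>a b. \<phi> (cstar a * b))"
proof (rule semi_inner_kform)
  fix n and x :: "nat \<Rightarrow> 'a" and \<xi> :: "nat \<Rightarrow> 'h"
  \<comment> \<open>The witness is the matrix with \<open>x\<close> as row 0 and zeros in all other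
    rows; row 0 is in range because \<open>i < n\<close>.\<close>
  have "mpos_alg n (\<lambda>i j. cstar (x i) * x j)"
    unfolding mpos_alg_def
  proof (intro exI allI impI)
    fix i j assume "i < n" "j < n"
    have "(\<Sum>k<n. cstar (if k = 0 then x i else 0) * (if k = 0 then x j else 0)) =
        (\<Sum>k<n. if k = 0 then cstar (x i) * x j else 0)"
      by (rule sum.cong) auto
    then show "cstar (x i) * x j =
        (\<Sum>k<n. cstar (if k = 0 then x i else 0) * (if k = 0 then x j else 0))"
      using \<open>i < n\<close> by simp
  qed
  then have "mpos_op n (\<lambda>i j. \<phi> (cstar (x i) * x j))"
    using cp unfolding completely_positive_def by (elim conjE allE[of _ n] allE[of _ "\<lambda>i j. cstar (x i) * x j"]) blast
  then show "Im (\<Sum>i<n. \<Sum>j<n. cinner (\<xi> i) (\<phi> (cstar (x i) * x j) (\<xi> j))) = 0"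
    "0 \<le> Re (\<Sum>i<n. \<Sum>j<n. cinner (\<xi> i) (\<phi> (cstar (x i) * x j) (\<xi> j)))"
    unfolding mpos_op_def by blast+
qed (simp_all add: phi_add_arg phi_scaleC_arg)

definition state :: "'h \<Rightarrow> 'a \<Rightarrow> real" where "state \<xi> a = Re (cinner \<xi> (\<phi> a \<xi>))"

lemma state_add: "state \<xi> (a + b) = state \<xi> a + state \<xi> b"
  and state_diff: "state \<xi> (a - b) = state \<xi> a - state \<xi> b"
  and state_scaleR: "state \<xi> (r *\<^sub>R a) = r * state \<xi> a"
  and state_zero [simp]: "state \<xi> 0 = 0"
  by (simp_all add: state_def phi_add phi_diff phi_scaleC cinner_add_right cinner_diff_right
      scaleR_scaleC cinner_scaleC_right)

lemma state_nonneg: "0 \<le> state \<xi> (cstar a * a)"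
  using alg.pos[of "[(a, \<xi>)]"] by (simp add: state_def)

lemma cauchy_schwarz:
  "(cmod (cinner \<xi> (\<phi> (cstar a * b) \<eta>)))\<^sup>2 \<le> state \<xi> (cstar a * a) * state \<eta> (cstar b * b)"
  using alg.cauchy_schwarz[of "[(a, \<xi>)]" "[(b, \<eta>)]"] by (simp add: state_def)

lemma hermitian_product: "cinner \<xi> (\<phi> (cstar a * b) \<eta>) = cnj (cinner \<eta> (\<phi> (cstar b * a) \<xi>))"
  using alg.hermitian[of "[(a, \<xi>)]" "[(b, \<eta>)]"] by simp

lemma gram_nonneg_alg:
  fixes n :: nat
  shows "0 \<le> Re (\<Sum>i<n. \<Sum>j<n. cinner (\<xi> i) (\<phi> (cstar (a i) * a j) (\<xi> j)))"
  using alg.pos[of "map (\<lambda>i. (a i, \<xi> i)) [0..<n]"] by (simp only: kform_map_upt)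

text \<open>If \<open>h = (u* u) / (4 \<parallel>u\<parallel>\<^sup>2)\<close> then \<open>1 - h = (1 - v)\<^sup>2\<close>, so \<open>c* c - c* h c\<close> is a square. This does
  not use continuity of \<open>\<phi>\<close>.\<close>
lemma state_mult_le: "state \<xi> (cstar (u * c) * (u * c)) \<le> 4 * (norm u)\<^sup>2 * state \<xi> (cstar c * c)"
proof (cases "u = 0")
  case False
  define r where "r = 1 / (4 * (norm u)\<^sup>2)"
  have r: "0 < r" using False by (simp add: r_def)
  define h where "h = r *\<^sub>R (cstar u * u)"
  have "cstar h = h" by (simp add: h_def cstar_linear)
  moreover have "norm h < 1" using False by (simp add: h_def r_def cstar_identity)
  ultimately obtain v where v: "cstar v = v" "v + v - v * v = h" using hermitian_sqrt by blast
  have "cstar (c - v * c) * (c - v * c) = cstar c * c - cstar c * (v + v - v * v) * c"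
    by (simp add: cstar_linear v(1) algebra_simps)
  also have "\<dots> = cstar c * c - r *\<^sub>R (cstar (u * c) * (u * c))"
    unfolding v(2) by (simp add: h_def cstar_mult mult.assoc)
  finally have "0 \<le> state \<xi> (cstar c * c) - r * state \<xi> (cstar (u * c) * (u * c))"
    using state_nonneg[of \<xi> "c - v * c"] by (simp add: state_diff state_scaleR)
  then show ?thesis using False by (simp add: r_def field_simps)
qed (simp add: state_nonneg)

text \<open>In a two-sided factorisation Cauchy-Schwarz isolates \<open>v n * d\<close>, and
  \<open>state_mult_le\<close> pulls out \<open>norm (v n)\<close>; the rest is independent of
  \<open>n\<close>.\<close>

lemma phi_null:
  assumes a: "a \<longlonglongrightarrow> 0"
  shows "(\<lambda>n. cinner \<xi> (\<phi> (a n) \<eta>)) \<longlonglongrightarrow> 0"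
proof -
  obtain v c d where v: "v \<longlonglongrightarrow> 0" "\<And>n. a n = cstar c * (v n * d)"
    using cohen_factorization_two_sided[OF a] by blast
  define K where "K = 2 * sqrt (state \<xi> (cstar c * c) * state \<eta> (cstar d * d))"
  have "norm (cinner \<xi> (\<phi> (a n) \<eta>)) \<le> norm (v n) * K" for n
  proof -
    have "(cmod (cinner \<xi> (\<phi> (a n) \<eta>)))\<^sup>2
        \<le> state \<xi> (cstar c * c) * state \<eta> (cstar (v n * d) * (v n * d))"
      unfolding v(2) by (rule cauchy_schwarz)
    also have "\<dots> \<le> state \<xi> (cstar c * c) * (4 * (norm (v n))\<^sup>2 * state \<eta> (cstar d * d))"
      by (intro mult_left_mono state_mult_le state_nonneg)
    also have "\<dots> = (2 * norm (v n))\<^sup>2 * (state \<xi> (cstar c * c) * state \<eta> (cstar d * d))"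
      by (simp add: power_mult_distrib)
    finally have "cmod (cinner \<xi> (\<phi> (a n) \<eta>))
        \<le> sqrt ((2 * norm (v n))\<^sup>2 * (state \<xi> (cstar c * c) * state \<eta> (cstar d * d)))"
      by (rule real_le_rsqrt)
    then show ?thesis by (simp add: K_def real_sqrt_mult)
  qed
  then show ?thesis
    by (intro Lim_null_comparison[OF _ tendsto_mult_left_zero[OF tendsto_norm_zero[OF v(1)], of K]]) auto
qed

text \<open>Every element is a product: factor the null sequence \<open>a / (n + 1)\<close> and read
  off the term at \<open>n = 0\<close>. This reduces the claim to
  \<open>hermitian_product\<close>.\<close>

lemma hermitian: "cinner \<xi> (\<phi> a \<eta>) = cnj (cinner \<eta> (\<phi> (cstar a) \<xi>))"
proof -
  have "(\<lambda>n. inverse (real (Suc n)) *\<^sub>R a) \<longlonglongrightarrow> 0 *\<^sub>R a"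
    by (intro tendsto_intros LIMSEQ_inverse_real_of_nat)
  then obtain u c where "\<forall>n. inverse (real (Suc n)) *\<^sub>R a = u n * c"
    using cohen_factorization[of "\<lambda>n. inverse (real (Suc n)) *\<^sub>R a"] by auto
  then have "inverse (real (Suc 0)) *\<^sub>R a = u 0 * c" by blast
  then have a: "a = cstar (cstar (u 0)) * c" by simp
  show ?thesis unfolding a by (subst hermitian_product) (simp add: cstar_mult)
qed

end

section \<open>Gram matrices in a Hilbert module\<close>

locale cp_module = cp_map \<phi> for \<phi> :: "'a::cstar_algebra \<Rightarrow> 'h::chilbert_space \<Rightarrow> 'h" +
  fixes act :: "'e::complex_vector \<Rightarrow> 'a \<Rightarrow> 'e" and ip :: "'e \<Rightarrow> 'e \<Rightarrow> 'a"
  assumes module: "hilbert_module act ip"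
begin

lemma ip_add_right: "ip x (y + z) = ip x y + ip x z"
  and ip_scaleC_right: "ip x (c *\<^sub>C y) = c *\<^sub>C ip x y"
  and ip_act_right: "ip x (act y a) = ip x y * a"
  and cstar_ip: "cstar (ip x y) = ip y x"
  and ip_self: "\<exists>b. ip x x = cstar b * b"
  using module unfolding hilbert_module_def apos_def by simp_all

lemma ip_add_left: "ip (x + y) z = ip x z + ip y z"
  by (metis cstar_add cstar_ip ip_add_right)

lemma ip_scaleC_left: "ip (c *\<^sub>C x) y = cnj c *\<^sub>C ip x y"
  by (metis cstar_scaleC cstar_ip ip_scaleC_right)

lemma ip_act_left: "ip (act x a) y = cstar a * ip x y"
  by (metis cstar_mult cstar_ip ip_act_right)

lemma ip_zero_right [simp]: "ip x 0 = 0"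
  by (metis add_cancel_right_left ip_add_right)

lemma ip_zero_left [simp]: "ip 0 x = 0"
  by (metis add_cancel_right_left ip_add_left)

lemma ip_minus_right [simp]: "ip x (- y) = - ip x y"
  using ip_add_right[of x y "- y"] by (simp add: eq_neg_iff_add_eq_0 add.commute)

lemma ip_minus_left [simp]: "ip (- x) y = - ip x y"
  using ip_add_left[of x "- x" y] by (simp add: eq_neg_iff_add_eq_0 add.commute)

lemma ip_diff_right: "ip x (y - z) = ip x y - ip x z"
  by (metis diff_conv_add_uminus ip_add_right ip_minus_right)

lemma ip_diff_left: "ip (x - y) z = ip x z - ip y z"
  by (metis diff_conv_add_uminus ip_add_left ip_minus_left)

lemmas ip_linear = ip_add_left ip_add_right ip_diff_left ip_diff_right
  ip_scaleC_left ip_scaleC_right ip_act_left ip_act_right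

lemma state_ip_nonneg: "0 \<le> state \<xi> (cstar a * ip x x * a)"
proof -
  obtain b where "ip x x = cstar b * b" using ip_self by blast
  then have "cstar a * ip x x * a = cstar (b * a) * (b * a)" by (simp add: cstar_mult mult.assoc)
  then show ?thesis by (metis state_nonneg)
qed

text \<open>\<open>x - p m\<close>, with \<open>m = (\<langle>p,p\<rangle> - i d)\<^sup>-\<^sup>1 \<langle>p,x\<rangle>\<close>, is an approximate Gram-Schmidt step. The imaginary
  regularisation makes the error in the Gram matrix the exact square \<open>m* \<langle>p,p\<rangle> m\<close>.\<close>
context
  fixes p :: 'e and d :: real
  assumes d: "0 < d"
begin

abbreviation (input) D :: complex where "D \<equiv> \<i> * complex_of_real d"

lemma ip_resolvent:
  assumes "ip p p * m - D *\<^sub>C m = ip p x"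
  shows "ip p x = ip p p * m - D *\<^sub>C m" "ip x p = cstar m * ip p p + D *\<^sub>C cstar m"
proof -
  show "ip p x = ip p p * m - D *\<^sub>C m" using assms by simp
  then have "cstar (ip p x) = cstar (ip p p * m - D *\<^sub>C m)" by simp
  then show "ip x p = cstar m * ip p p + D *\<^sub>C cstar m"
    by (simp add: cstar_linear cstar_ip)
qed

lemma schur_complement:
  assumes m: "ip p p * m - D *\<^sub>C m = ip p x" and m': "ip p p * m' - D *\<^sub>C m' = ip p x'"
  shows "ip (x - act p m) (x' - act p m') = ip x x' - cstar m * ip p p * m'"
proof -
  have "ip (x - act p m) (x' - act p m')
      = ip x x' - ip x p * m' - cstar m * ip p x' + cstar m * ip p p * m'"
    by (simp add: ip_linear algebra_simps)
  also have "\<dots> = ip x x' - cstar m * ip p p * m'"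
    unfolding ip_resolvent(2)[OF m] ip_resolvent(1)[OF m']
    by (simp add: algebra_simps mult_scaleC)
  finally show ?thesis .
qed

text \<open>The inner squares of \<open>x - p m\<close> and \<open>x + i p m\<close> add up to
  \<open>2 (ip x x - d cstar m m)\<close>, because the terms \<open>cstar m * ip p p * m\<close>
  cancel. Both are positive.\<close>

lemma schur_residual:
  assumes m: "ip p p * m - D *\<^sub>C m = ip p x"
  shows "d * state \<xi> (cstar (m * a) * (m * a)) \<le> state \<xi> (cstar a * ip x x * a)"
proof -
  have "ip (x + \<i> *\<^sub>C act p m) (x + \<i> *\<^sub>C act p m)
      = ip x x + \<i> *\<^sub>C (ip x p * m) - \<i> *\<^sub>C (cstar m * ip p x) + cstar m * ip p p * m"
    by (simp add: ip_linear algebra_simps scaleC_linear mult_scaleC)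
  also have "\<dots> = ip x x + (\<i> * D) *\<^sub>C (cstar m * m) + (\<i> * D) *\<^sub>C (cstar m * m) + cstar m * ip p p * m"
    unfolding ip_resolvent[OF m]
    by (simp only: distrib_right right_diff_distrib mult_scaleC scaleC_linear scaleC_scaleC mult.assoc) simp
  also have "\<i> * D = complex_of_real (- d)" by (simp add: complex_eq_iff)
  finally have "ip (x + \<i> *\<^sub>C act p m) (x + \<i> *\<^sub>C act p m)
      = ip x x + (- d) *\<^sub>R (cstar m * m) + (- d) *\<^sub>R (cstar m * m) + cstar m * ip p p * m"
    by (simp only: scaleR_scaleC)
  then have "ip (x - act p m) (x - act p m) + ip (x + \<i> *\<^sub>C act p m) (x + \<i> *\<^sub>C act p m)
      = 2 *\<^sub>R (ip x x - d *\<^sub>R (cstar m * m))"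
    unfolding schur_complement[OF m m] by (simp add: scaleR_2)
  then have "cstar a * ip (x - act p m) (x - act p m) * a
        + cstar a * ip (x + \<i> *\<^sub>C act p m) (x + \<i> *\<^sub>C act p m) * a
      = cstar a * (2 *\<^sub>R (ip x x - d *\<^sub>R (cstar m * m))) * a"
    by (metis distrib_left distrib_right)
  also have "\<dots> = 2 *\<^sub>R (cstar a * ip x x * a - d *\<^sub>R (cstar (m * a) * (m * a)))"
    by (simp add: right_diff_distrib left_diff_distrib cstar_mult mult.assoc)
  finally have "0 \<le> state \<xi> (2 *\<^sub>R (cstar a * ip x x * a - d *\<^sub>R (cstar (m * a) * (m * a))))"
    by (metis state_add state_ip_nonneg add_nonneg_nonneg)
  then show ?thesis by (simp add: state_scaleR state_diff)
qed

text \<open>The mixed entry is \<open>- i d (m - cstar w * m)\<close>. Cauchy-Schwarz separates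
  \<open>(1 - w) a\<close>, controlled by the Cayley relation, from \<open>m b\<close>, where
  \<open>schur_residual\<close> absorbs one of the two powers of \<open>d\<close>.\<close>

lemma schur_cross:
  assumes w: "ip p p * w - D *\<^sub>C w = ip p p" and m: "ip p p * m - D *\<^sub>C m = ip p x"
  shows "(cmod (cinner \<xi> (\<phi> (cstar a * ip (p - act p w) (x - act p m) * b) \<eta>)))\<^sup>2
    \<le> d * (state \<xi> (cstar a * a) * state \<eta> (cstar b * ip x x * b))"
proof -
  let ?z = "cstar (a - w * a) * (m * b)"
  have g: "cstar (ip p p) = ip p p" by (rule cstar_ip)
  have wg: "cstar w * ip p p = ip p p - D *\<^sub>C cstar w"
    using ip_resolvent(2)[OF w] by (simp add: algebra_simps)
  have "ip (p - act p w) (x - act p m) = - (D *\<^sub>C (m - cstar w * m))"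
    unfolding schur_complement[OF w m] ip_resolvent(1)[OF m] wg
    by (simp add: algebra_simps mult_scaleC scaleC_linear)
  then have eq: "cstar a * ip (p - act p w) (x - act p m) * b = - (D *\<^sub>C ?z)"
    by (simp add: mult_scaleC cstar_linear algebra_simps)
  have "cstar (a - w * a) * (a - w * a)
      = cstar a * a - cstar a * (w + cstar w) * a + cstar a * (cstar w * w) * a"
    by (simp add: cstar_linear algebra_simps)
  also have "\<dots> = cstar a * a - cstar (w * a) * (w * a)"
    unfolding resolvent_relation[OF g _ w, simplified, OF d[THEN less_imp_neq, symmetric]]
    by (simp add: cstar_mult algebra_simps)
  finally have "state \<xi> (cstar (a - w * a) * (a - w * a)) \<le> state \<xi> (cstar a * a)"
    using state_nonneg[of \<xi> "w * a"] by (simp add: state_diff)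
  then have "(cmod (cinner \<xi> (\<phi> ?z \<eta>)))\<^sup>2 \<le> state \<xi> (cstar a * a) * state \<eta> (cstar (m * b) * (m * b))"
    by (intro order_trans[OF cauchy_schwarz] mult_right_mono state_nonneg)
  then have "d\<^sup>2 * (cmod (cinner \<xi> (\<phi> ?z \<eta>)))\<^sup>2
      \<le> d\<^sup>2 * (state \<xi> (cstar a * a) * state \<eta> (cstar (m * b) * (m * b)))"
    by (intro mult_left_mono) auto
  also have "\<dots> = d * (state \<xi> (cstar a * a) * (d * state \<eta> (cstar (m * b) * (m * b))))"
    by (simp add: power2_eq_square)
  also have "\<dots> \<le> d * (state \<xi> (cstar a * a) * state \<eta> (cstar b * ip x x * b))"
    using d by (intro mult_left_mono schur_residual[OF m] state_nonneg) auto
  finally show ?thesis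
    unfolding eq by (simp add: phi_scaleC cinner_scaleC_right norm_mult power_mult_distrib)
qed

end

text \<open>Induction with the last vector as pivot, replacing \<open>x\<close> by the reduced
  family \<open>y\<close>. The Gram matrix is an exact square plus that of \<open>y\<close>; there
  the first \<open>n\<close> vectors fall under the induction hypothesis, the corner is positive and
  the cross terms vanish with \<open>e\<close>.\<close>

lemma gram_nonneg_aux:
  fixes n :: nat
  shows "0 \<le> Re (\<Sum>i<n. \<Sum>j<n. cinner (\<xi> i) (\<phi> (cstar (a i) * ip (x i) (x j) * a j) (\<xi> j)))"
proof (induction n arbitrary: x)
  case (Suc n)
  define S where "S n x = (\<Sum>i<n. \<Sum>j<n. cinner (\<xi> i) (\<phi> (cstar (a i) * ip (x i) (x j) * a j) (\<xi> j)))" for n and x :: "nat \<Rightarrow> 'e"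
  let ?p = "x n"
  define K where "K = (\<Sum>j<n. sqrt (state (\<xi> n) (cstar (a n) * a n) * state (\<xi> j) (cstar (a j) * ip (x j) (x j) * a j)))"
  have K: "0 \<le> K" unfolding K_def
    by (intro sum_nonneg real_sqrt_ge_zero mult_nonneg_nonneg state_nonneg state_ip_nonneg)
  have main: "0 \<le> Re (S (Suc n) x) + 2 * (e * K)" if e: "0 < e" for e
  proof -
    \<comment> \<open>The squared cross terms are of order \<open>d\<close>, so
      \<open>d = e\<^sup>2\<close> bounds the cross terms by a multiple of \<open>e\<close>.\<close>
    let ?D = "\<i> * complex_of_real (e\<^sup>2)"
    have e2: "0 < e\<^sup>2" using e by simp
    have "\<exists>m. ip ?p ?p * m - ?D *\<^sub>C m = ip ?p (x j)" for j
      by (rule hermitian_resolvent) (use e in \<open>simp_all add: cstar_ip\<close>)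
    then obtain m where m: "\<And>j. ip ?p ?p * m j - ?D *\<^sub>C m j = ip ?p (x j)" by metis
    define y where "y j = x j - act ?p (m j)" for j
    obtain b where b: "ip ?p ?p = cstar b * b" using ip_self by blast
    have "cstar (a i) * ip (x i) (x j) * a j = cstar (a i) * ip (y i) (y j) * a j
        + cstar (b * m i * a i) * (b * m j * a j)" for i j
      unfolding y_def schur_complement[OF e2 m m] by (simp add: b cstar_mult algebra_simps)
    then have "S (Suc n) x = S (Suc n) y
        + (\<Sum>i<Suc n. \<Sum>j<Suc n. cinner (\<xi> i) (\<phi> (cstar (b * m i * a i) * (b * m j * a j)) (\<xi> j)))"
      unfolding S_def by (simp only: phi_add cinner_add_right sum.distrib)
    then have 1: "Re (S (Suc n) y) \<le> Re (S (Suc n) x)"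
      using gram_nonneg_alg[of \<xi> "\<lambda>i. b * m i * a i" "Suc n"] by (simp del: sum.lessThan_Suc)
    define c where "c i j = cinner (\<xi> i) (\<phi> (cstar (a i) * ip (y i) (y j) * a j) (\<xi> j))" for i j
    have sym: "c j n = cnj (c n j)" for j
      unfolding c_def by (subst hermitian) (simp add: cstar_mult cstar_ip mult.assoc)
    have split: "S (Suc n) y = S n y + c n n + (\<Sum>j<n. c n j + c j n)"
      unfolding S_def c_def[symmetric] by (simp add: sum.distrib)
    then have "Re (S (Suc n) y) = Re (S n y) + Re (c n n) + 2 * (\<Sum>j<n. Re (c n j))"
    proof -
      have "Re (c n j + c j n) = 2 * Re (c n j)" for j by (subst sym) simp
      then have "Re (\<Sum>j<n. c n j + c j n) = 2 * (\<Sum>j<n. Re (c n j))"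
        by (simp only: Re_sum sum_distrib_left)
      then show ?thesis using split by simp
    qed
    moreover have "0 \<le> Re (S n y)" unfolding S_def by (rule Suc.IH)
    moreover have "0 \<le> Re (c n n)" using state_ip_nonneg[of "\<xi> n"] by (simp add: c_def state_def)
    moreover have "- (e * K) \<le> (\<Sum>j<n. Re (c n j))"
    proof -
      have "- (e * sqrt (state (\<xi> n) (cstar (a n) * a n) * state (\<xi> j) (cstar (a j) * ip (x j) (x j) * a j)))
          \<le> Re (c n j)" for j
      proof -
        have "(cmod (c n j))\<^sup>2 \<le> e\<^sup>2 * (state (\<xi> n) (cstar (a n) * a n) * state (\<xi> j) (cstar (a j) * ip (x j) (x j) * a j))"
          unfolding c_def y_def by (rule schur_cross[OF e2 m m])
        then have "cmod (c n j) \<le> e * sqrt (state (\<xi> n) (cstar (a n) * a n) * state (\<xi> j) (cstar (a j) * ip (x j) (x j) * a j))"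
          using real_le_rsqrt e by (fastforce simp: real_sqrt_mult)
        then show ?thesis using abs_Re_le_cmod[of "c n j"] by linarith
      qed
      then show ?thesis unfolding K_def sum_distrib_left sum_negf[symmetric] by (intro sum_mono)
    qed
    ultimately show ?thesis using 1 by linarith
  qed
  have "0 \<le> Re (S (Suc n) x)"
  proof (rule field_le_epsilon)
    fix e :: real assume e: "0 < e"
    \<comment> \<open>\<open>K + 1\<close> in the denominator covers the case
      \<open>K = 0\<close>.\<close>
    define e' where "e' = e / (2 * (K + 1))"
    have "0 < e'" using e K by (simp add: e'_def)
    moreover have "2 * (e' * K) \<le> e" using e K by (simp add: e'_def field_simps)
    ultimately show "0 \<le> Re (S (Suc n) x) + e" using main[of e'] by linarith
  qed
  then show ?case by (simp only: S_def)
qed simp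

text \<open>One sequence of near-units serves the finitely many entries. Conjugated by it, the form
  is nonnegative by \<open>gram_nonneg_aux\<close>, and \<open>phi_null\<close> passes to the
  limit.\<close>

lemma gram_nonneg:
  fixes n :: nat
  shows "0 \<le> Re (\<Sum>i<n. \<Sum>j<n. cinner (\<xi> i) (\<phi> (ip (x i) (x j)) (\<xi> j)))"
proof -
  define G where "G = (\<lambda>(i, j). ip (x i) (x j)) ` ({..<n} \<times> {..<n})"
  have "\<exists>w. near_unit w \<and> (\<forall>g\<in>G. norm (g - g * w) \<le> inverse (real (Suc k)))" for k
    by (rule right_unit_finite) (auto simp: G_def)
  then obtain w where w: "\<And>k. near_unit (w k)" "\<And>k g. g \<in> G \<Longrightarrow> norm (g - g * w k) \<le> inverse (real (Suc k))"
    by metis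
  have lim: "(\<lambda>k. cinner (\<xi> i) (\<phi> (cstar (w k) * ip (x i) (x j) * w k) (\<xi> j))) \<longlonglongrightarrow> cinner (\<xi> i) (\<phi> (ip (x i) (x j)) (\<xi> j))"
    if ij: "i < n" "j < n" for i j
  proof -
    let ?g = "ip (x i) (x j)"
    have "norm (?g - cstar (w k) * ?g * w k) \<le> inverse (real (Suc k)) * 3" for k
    proof -
      \<comment> \<open>The adjoint of an entry is again an entry of \<open>G\<close>, so the right
        estimate also controls \<open>cstar (w k)\<close> on the left. The total factor is
        \<open>1 + 2\<close>, since \<open>norm (w k) \<le> 2\<close>.\<close>
      have "norm (?g - cstar (w k) * ?g) = norm (cstar (?g - cstar (w k) * ?g))" by simp
      also have "cstar (?g - cstar (w k) * ?g) = ip (x j) (x i) - ip (x j) (x i) * w k"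
        by (simp add: cstar_linear cstar_ip)
      also have "norm \<dots> \<le> inverse (real (Suc k))" by (rule w(2)) (use ij in \<open>auto simp: G_def\<close>)
      finally have "norm ((?g - cstar (w k) * ?g) * w k) \<le> inverse (real (Suc k)) * 2"
        by (intro order_trans[OF norm_mult_ineq] mult_mono near_unit_norm w) auto
      moreover have "norm (?g - ?g * w k) \<le> inverse (real (Suc k))"
        by (rule w(2)) (use ij in \<open>auto simp: G_def\<close>)
      moreover have "?g - cstar (w k) * ?g * w k = (?g - ?g * w k) + (?g - cstar (w k) * ?g) * w k"
        by (simp add: algebra_simps)
      ultimately show ?thesis
        using norm_triangle_ineq[of "?g - ?g * w k" "(?g - cstar (w k) * ?g) * w k"] by (simp only:)
    qed
    then have "(\<lambda>k. ?g - cstar (w k) * ?g * w k) \<longlonglongrightarrow> 0"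
      by (intro Lim_null_comparison[OF _ tendsto_mult_left_zero[OF LIMSEQ_inverse_real_of_nat, of 3]]) auto
    from phi_null[OF this, of "\<xi> i" "\<xi> j"]
    have "(\<lambda>k. cinner (\<xi> i) (\<phi> (?g - cstar (w k) * ?g * w k) (\<xi> j))) \<longlonglongrightarrow> 0" .
    from tendsto_diff[OF tendsto_const this, of "cinner (\<xi> i) (\<phi> ?g (\<xi> j))"] show ?thesis
      by (simp add: phi_diff cinner_diff_right)
  qed
  have "(\<lambda>k. \<Sum>i<n. \<Sum>j<n. cinner (\<xi> i) (\<phi> (cstar (w k) * ip (x i) (x j) * w k) (\<xi> j)))
      \<longlonglongrightarrow> (\<Sum>i<n. \<Sum>j<n. cinner (\<xi> i) (\<phi> (ip (x i) (x j)) (\<xi> j)))"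
    by (intro tendsto_sum lim) auto
  from tendsto_Re[OF this] show ?thesis
    by (rule LIMSEQ_le_const) (use gram_nonneg_aux[of \<xi> "\<lambda>_. w _"] in auto)
qed

lemma gram_real:
  fixes n :: nat
  shows "Im (\<Sum>i<n. \<Sum>j<n. cinner (\<xi> i) (\<phi> (ip (x i) (x j)) (\<xi> j))) = 0" (is "Im ?S = 0")
proof -
  have "cnj ?S = (\<Sum>i<n. \<Sum>j<n. cinner (\<xi> j) (\<phi> (ip (x j) (x i)) (\<xi> i)))"
    unfolding cnj_sum by (intro sum.cong refl) (subst hermitian, simp add: cstar_ip)
  also have "\<dots> = ?S" by (rule sum.swap)
  finally have "cnj ?S = ?S" .
  moreover have "Im z = 0" if "cnj z = z" for z using that by (simp add: complex_eq_iff)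
  ultimately show ?thesis by blast
qed

sublocale tensor: semi_inner "(@)" lsmul "kform (\<lambda>x y. \<phi> (ip x y))"
  by (rule semi_inner_kform) (simp_all only: phi_add_arg phi_scaleC_arg gram_nonneg gram_real)

end

section \<open>Extension of completely semi-phi-maps\<close>

text \<open>The extension is \<open>T P\<close>, with \<open>P\<close> the orthogonal projection onto the closure of \<open>M\<close>. As the semi-inner
  product space need not be complete, \<open>P v\<close> is replaced by a sequence in \<open>M\<close> that represents
  \<open>B v\<close> on \<open>M\<close> better and better.\<close>
lemma (in semi_inner) contraction_extension:
  fixes T :: "'v \<Rightarrow> 'h::chilbert_space"
  assumes M: "M \<noteq> {}" "\<And>u v. u \<in> M \<Longrightarrow> v \<in> M \<Longrightarrow> plus u v \<in> M" "\<And>c u. u \<in> M \<Longrightarrow> smul c u \<in> M"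
    and T_add: "\<And>u v. T (plus u v) = T u + T v" and T_smul: "\<And>c u. T (smul c u) = c *\<^sub>C T u"
    and T_le: "\<And>u. u \<in> M \<Longrightarrow> (norm (T u))\<^sup>2 \<le> Q u"
  shows "\<exists>S. (\<forall>u v. S (plus u v) = S u + S v) \<and> (\<forall>c u. S (smul c u) = c *\<^sub>C S u) \<and>
    (\<forall>u. (norm (S u))\<^sup>2 \<le> Q u) \<and> (\<forall>u\<in>M. S u = T u) \<and>
    ((\<forall>u\<in>M. \<forall>v\<in>M. cinner (T u) (T v) = B u v) \<longrightarrow> (\<forall>v. \<forall>u\<in>M. cinner (S v) (T u) = B v u))"
proof -
  \<comment> \<open>\<open>m\<close> approximates the projection of \<open>v\<close> to
    \<open>M\<close>: it represents \<open>B v\<close> on \<open>M\<close> up to \<open>e\<close> in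
    the dual seminorm.\<close>
  define A where "A v m e \<longleftrightarrow> m \<in> M \<and> 0 \<le> e \<and> (\<forall>u\<in>M. cmod (B v u - B m u) \<le> e * sqrt (Q u))" for v m e
  have A_add: "A (plus v v') (plus m m') (e + e')" if "A v m e" "A v' m' e'" for v v' m m' e e'
    unfolding A_def
  proof (intro conjI ballI)
    show "0 \<le> e + e'" using that by (simp add: A_def)
    show "plus m m' \<in> M" using that M by (simp add: A_def)
    fix u assume "u \<in> M"
    then have "cmod ((B v u - B m u) + (B v' u - B m' u)) \<le> e * sqrt (Q u) + e' * sqrt (Q u)"
      using that by (intro norm_triangle_le add_mono) (auto simp: A_def)
    then show "cmod (B (plus v v') u - B (plus m m') u) \<le> (e + e') * sqrt (Q u)"
      by (simp add: add_left algebra_simps)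
  qed
  have A_smul: "A (smul c v) (smul c m) (cmod c * e)" if "A v m e" for c v m e
    unfolding A_def
  proof (intro conjI ballI)
    show "0 \<le> cmod c * e" using that by (simp add: A_def)
    show "smul c m \<in> M" using that M by (simp add: A_def)
    fix u assume "u \<in> M"
    then have "cmod c * cmod (B v u - B m u) \<le> cmod c * (e * sqrt (Q u))"
      using that by (intro mult_left_mono) (auto simp: A_def)
    moreover have "B (smul c v) u - B (smul c m) u = cnj c * (B v u - B m u)"
      by (simp add: smul_left right_diff_distrib)
    ultimately show "cmod (B (smul c v) u - B (smul c m) u) \<le> cmod c * e * sqrt (Q u)"
      by (simp add: norm_mult)
  qed
  \<comment> \<open>Testing the approximation on \<open>m\<close> itself gives
    \<open>Q m \<le> (sqrt (Q v) + e) * sqrt (Q m)\<close>.\<close>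
  have A_bound: "norm (T m) \<le> sqrt (Q v) + e" if "A v m e" for v m e
  proof -
    have m: "m \<in> M" using that by (simp add: A_def)
    have "cmod (B v m) \<le> sqrt (Q v) * sqrt (Q m)"
      using real_le_rsqrt[OF cauchy_schwarz[of v m]] by (simp add: real_sqrt_mult)
    moreover have "cmod (B v m - B m m) \<le> e * sqrt (Q m)" using that m by (simp add: A_def)
    moreover have "cmod (B m m) = sqrt (Q m) * sqrt (Q m)"
      using pos[of m] by (subst self_eq) (simp del: of_real_Re)
    ultimately have "sqrt (Q m) * sqrt (Q m) \<le> (sqrt (Q v) + e) * sqrt (Q m)"
      using norm_triangle_sub[of "B m m" "B v m"] by (simp add: norm_minus_commute algebra_simps)
    then have "sqrt (Q m) \<le> sqrt (Q v) + e"
      using pos[of m] pos[of v] that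
      by (cases "Q m = 0") (auto simp: A_def less_le dest!: mult_right_le_imp_le simp del: real_sqrt_mult_self)
    moreover have "norm (T m) \<le> sqrt (Q m)" using T_le[OF m] by (rule real_le_rsqrt)
    ultimately show ?thesis by linarith
  qed
  let ?sub = "\<lambda>u v. plus u (smul (-1) v)"
  have T_sub: "T (?sub u v) = T u - T v" for u v by (simp add: T_add T_smul)
  have Q_sub: "Q (?sub v v) = 0" for v by (simp add: Q_plus_smul)
  \<comment> \<open>\<open>R\<close> becomes the graph of \<open>S\<close>: a linear relation whose
    bound makes it single-valued and which is total by completeness.\<close>
  define R where "R v h \<longleftrightarrow> (\<exists>m e. (\<forall>k. A v (m k) (e k)) \<and> e \<longlonglongrightarrow> 0 \<and> (\<lambda>k. T (m k)) \<longlonglongrightarrow> h)" for v h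
  have R_add: "R (plus v v') (h + h')" if "R v h" "R v' h'" for v v' h h'
  proof -
    obtain m e where m: "\<And>k. A v (m k) (e k)" "e \<longlonglongrightarrow> 0" "(\<lambda>k. T (m k)) \<longlonglongrightarrow> h"
      using \<open>R v h\<close> unfolding R_def by blast
    obtain m' e' where m': "\<And>k. A v' (m' k) (e' k)" "e' \<longlonglongrightarrow> 0" "(\<lambda>k. T (m' k)) \<longlonglongrightarrow> h'"
      using \<open>R v' h'\<close> unfolding R_def by blast
    have "(\<lambda>k. e k + e' k) \<longlonglongrightarrow> 0" using tendsto_add[OF m(2) m'(2)] by simp
    moreover have "(\<lambda>k. T (plus (m k) (m' k))) \<longlonglongrightarrow> h + h'"
      unfolding T_add by (intro tendsto_add m m')
    moreover have "\<forall>k. A (plus v v') (plus (m k) (m' k)) (e k + e' k)" using A_add m(1) m'(1) by blast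
    ultimately show ?thesis unfolding R_def
      by (intro exI[of _ "\<lambda>k. plus (m k) (m' k)"] exI[of _ "\<lambda>k. e k + e' k"]) blast
  qed
  have R_smul: "R (smul c v) (c *\<^sub>C h)" if "R v h" for c v h
  proof -
    obtain m e where m: "\<And>k. A v (m k) (e k)" "e \<longlonglongrightarrow> 0" "(\<lambda>k. T (m k)) \<longlonglongrightarrow> h"
      using \<open>R v h\<close> unfolding R_def by blast
    have "(\<lambda>k. cmod c * e k) \<longlonglongrightarrow> 0" by (rule tendsto_mult_right_zero[OF m(2)])
    moreover have "(\<lambda>k. c *\<^sub>C T (m k)) \<longlonglongrightarrow> c *\<^sub>C h"
    proof (rule LIM_zero_cancel, rule Lim_null_comparison)
      show "\<forall>\<^sub>F k in sequentially. norm (c *\<^sub>C T (m k) - c *\<^sub>C h) \<le> cmod c * norm (T (m k) - h)"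
        by (simp add: norm_scaleC flip: scaleC_diff_right)
      show "(\<lambda>k. cmod c * norm (T (m k) - h)) \<longlonglongrightarrow> 0"
        by (intro tendsto_mult_right_zero tendsto_norm_zero LIM_zero m)
    qed
    moreover have "\<forall>k. A (smul c v) (smul c (m k)) (cmod c * e k)" using A_smul m(1) by blast
    ultimately show ?thesis unfolding R_def T_smul[symmetric]
      by (intro exI[of _ "\<lambda>k. smul c (m k)"] exI[of _ "\<lambda>k. cmod c * e k"]) blast
  qed
  have R_bound: "norm h \<le> sqrt (Q v)" if R: "R v h" for v h
  proof -
    obtain m e where m: "\<And>k. A v (m k) (e k)" "e \<longlonglongrightarrow> 0" "(\<lambda>k. T (m k)) \<longlonglongrightarrow> h"
      using R unfolding R_def by blast
    have "(\<lambda>k. sqrt (Q v) + e k) \<longlonglongrightarrow> sqrt (Q v) + 0" by (intro tendsto_intros m)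
    then show ?thesis using LIMSEQ_le[OF tendsto_norm[OF m(3)]] A_bound[OF m(1)] by fastforce
  qed
  have R_ex: "\<exists>h. R v h" for v
  proof -
    have "\<exists>m. A v m (inverse (real (Suc k)))" for k
      using approx_riesz[of M "B v" "Q v" "inverse (real (Suc k))"] M cauchy_schwarz[of v]
      by (auto simp: A_def add_right smul_right pos)
    then obtain m where m: "\<And>k. A v (m k) (inverse (real (Suc k)))" by metis
    \<comment> \<open>\<open>m i - m j\<close> approximates \<open>v - v\<close>, where
      \<open>Q\<close> vanishes, so \<open>A_bound\<close> leaves only the two errors.\<close>
    have "norm (T (m i) - T (m j)) \<le> inverse (real (Suc i)) + inverse (real (Suc j))" for i j
      using A_bound[OF A_add[OF m[of i] A_smul[OF m[of j], of "-1"]]] by (simp add: T_sub Q_sub)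
    then obtain h where "(\<lambda>k. T (m k)) \<longlonglongrightarrow> h" using inverse_Suc_Cauchy[of "\<lambda>k. T (m k)"] by blast
    then show ?thesis unfolding R_def using m LIMSEQ_inverse_real_of_nat
      by (intro exI[of _ h] exI[of _ m] exI[of _ "\<lambda>k. inverse (real (Suc k))"]) blast
  qed
  have R_unique: "h = h'" if "R v h" "R v h'" for v h h'
    using R_bound[OF R_add[OF that(1) R_smul[OF that(2), of "-1"]]] by (simp add: Q_sub)
  obtain S where S: "\<And>v. R v (S v)" using R_ex by metis
  have "S u = T u" if "u \<in> M" for u
  proof -
    \<comment> \<open>A vector of \<open>M\<close> is its own projection: a constant sequence with
      error 0.\<close>
    have "R u (T u)"
      unfolding R_def by (intro exI[of _ "\<lambda>_. u"] exI[of _ "\<lambda>_. 0"]) (simp add: A_def that)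
    then show ?thesis using R_unique S by blast
  qed
  moreover have "cinner (S v) (T u) = B v u"
    if iso: "\<forall>u\<in>M. \<forall>v\<in>M. cinner (T u) (T v) = B u v" and u: "u \<in> M" for u v
  proof -
    obtain m e where m: "\<And>k. A v (m k) (e k)" "e \<longlonglongrightarrow> 0" "(\<lambda>k. T (m k)) \<longlonglongrightarrow> S v"
      using S[of v] unfolding R_def by blast
    have "(\<lambda>k. B v u - B (m k) u) \<longlonglongrightarrow> 0"
      by (rule Lim_null_comparison[OF _ tendsto_mult_left_zero[OF m(2), of "sqrt (Q u)"]])
        (use m(1) u in \<open>simp add: A_def\<close>)
    moreover have "(\<lambda>k. B v u - B (m k) u) \<longlonglongrightarrow> B v u - cinner (S v) (T u)"
    proof -
      \<comment> \<open>The isometry turns the form into an inner product of images, which passes to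
        the limit.\<close>
      have "B (m k) u = cinner (T (m k)) (T u)" for k using iso u m(1)[of k] by (simp add: A_def)
      then show ?thesis by (simp only:) (intro tendsto_intros tendsto_cinner_left m)
    qed
    ultimately show ?thesis using LIMSEQ_unique by fastforce
  qed
  moreover have "S (plus u v) = S u + S v" "S (smul c u) = c *\<^sub>C S u" for u v c
    using R_unique S R_add R_smul by blast+
  moreover have "(norm (S u))\<^sup>2 \<le> Q u" for u
    using power_mono[OF R_bound[OF S] norm_ge_zero, of u 2] pos[of u] by simp
  ultimately show ?thesis by blast
qed

text \<open>Once the adjoints are moved across, the sum over \<open>k\<close> comes out: each matrix
  row contributes its Gram form minus the squared norm of one vector.\<close>

lemma (in cp_module) semi_form_eq:
  fixes n :: nat and \<Phi> :: "'e \<Rightarrow> 'h \<Rightarrow> 'k::chilbert_space"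
  assumes "\<And>k j. k < n \<Longrightarrow> j < n \<Longrightarrow> bounded_clinear (\<Phi> (x k j))"
  shows "(\<Sum>i<n. \<Sum>j<n. cinner (\<xi> i) (\<phi> (\<Sum>k<n. ip (x k i) (x k j)) (\<xi> j)
        - (\<Sum>k<n. cadjoint (\<Phi> (x k i)) (\<Phi> (x k j) (\<xi> j)))))
    = (\<Sum>k<n. (\<Sum>i<n. \<Sum>j<n. cinner (\<xi> i) (\<phi> (ip (x k i) (x k j)) (\<xi> j)))
        - complex_of_real ((norm (\<Sum>j<n. \<Phi> (x k j) (\<xi> j)))\<^sup>2))"
proof -
  have "(\<Sum>i<n. \<Sum>j<n. cinner (\<xi> i) (\<phi> (\<Sum>k<n. ip (x k i) (x k j)) (\<xi> j)
        - (\<Sum>k<n. cadjoint (\<Phi> (x k i)) (\<Phi> (x k j) (\<xi> j)))))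
    = (\<Sum>i<n. \<Sum>j<n. \<Sum>k<n. cinner (\<xi> i) (\<phi> (ip (x k i) (x k j)) (\<xi> j))
        - cinner (\<Phi> (x k i) (\<xi> i)) (\<Phi> (x k j) (\<xi> j)))"
    using assms by (intro sum.cong refl)
      (simp add: cinner_diff_right phi_sum cinner_sum_right sum_subtractf cinner_cadjoint)
  also have "\<dots> = (\<Sum>k<n. \<Sum>i<n. \<Sum>j<n. cinner (\<xi> i) (\<phi> (ip (x k i) (x k j)) (\<xi> j))
        - cinner (\<Phi> (x k i) (\<xi> i)) (\<Phi> (x k j) (\<xi> j)))"
    by (subst sum.swap[of _ "{..<n}" "{..<n}"], subst sum.swap) (rule refl)
  also have "\<dots> = (\<Sum>k<n. (\<Sum>i<n. \<Sum>j<n. cinner (\<xi> i) (\<phi> (ip (x k i) (x k j)) (\<xi> j)))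
        - complex_of_real ((norm (\<Sum>j<n. \<Phi> (x k j) (\<xi> j)))\<^sup>2))"
    by (simp only: sum_subtractf cinner_norm[symmetric] cinner_sum_left) (simp only: cinner_sum_right)
  finally show ?thesis .
qed

text \<open>The matrix form is a sum of one contraction estimate per row; conversely, a single row
  is padded with zero rows to a square matrix.\<close>

lemma (in cp_module) completely_semi_phi_map_iff:
  fixes \<Phi> :: "'e \<Rightarrow> 'h \<Rightarrow> 'k::chilbert_space"
  assumes X: "0 \<in> X" and \<Phi>: "\<And>x. x \<in> X \<Longrightarrow> bounded_clinear (\<Phi> x)"
  shows "completely_semi_phi_map ip \<phi> X \<Phi> \<longleftrightarrow>
    (\<forall>(n::nat) x \<xi>. (\<forall>j<n. x j \<in> X) \<longrightarrow>
      (norm (\<Sum>j<n. \<Phi> (x j) (\<xi> j)))\<^sup>2 \<le> Re (\<Sum>i<n. \<Sum>j<n. cinner (\<xi> i) (\<phi> (ip (x i) (x j)) (\<xi> j))))"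
    (is "?L \<longleftrightarrow> ?R")
proof
  assume L: ?L
  show ?R
  proof (intro allI impI)
    fix n :: nat and x :: "nat \<Rightarrow> 'e" and \<xi>
    assume x: "\<forall>j<n. x j \<in> X"
    define y where "y k j = (if k = 0 then x j else 0)" for k j :: nat
    define D where "D k = (\<Sum>i<n. \<Sum>j<n. cinner (\<xi> i) (\<phi> (ip (y k i) (y k j)) (\<xi> j)))
        - complex_of_real ((norm (\<Sum>j<n. \<Phi> (y k j) (\<xi> j)))\<^sup>2)" for k
    have y: "\<forall>i<n. \<forall>j<n. y i j \<in> X" using x X by (simp add: y_def)
    then have "0 \<le> Re (\<Sum>k<n. D k)"
      using L \<Phi> unfolding completely_semi_phi_map_def mpos_op_def D_def
      by (subst semi_form_eq[symmetric]) blast+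
    \<comment> \<open>On a zero row the Gram form vanishes and minus a squared norm remains,
      whatever the value of \<open>\<Phi> 0\<close>.\<close>
    moreover have "Re (D k) \<le> 0" if "k \<noteq> 0" for k
      using that by (simp add: D_def y_def)
    ultimately have "0 \<le> Re (D 0)" if "n \<noteq> 0"
    proof -
      have "(\<Sum>k<n. Re (D k)) = Re (D 0) + (\<Sum>k\<in>{..<n} - {0}. Re (D k))"
        using that by (intro sum.remove) auto
      moreover have "(\<Sum>k\<in>{..<n} - {0}. Re (D k)) \<le> 0"
        using \<open>\<And>k. k \<noteq> 0 \<Longrightarrow> Re (D k) \<le> 0\<close> by (intro sum_nonpos) auto
      ultimately show ?thesis using \<open>0 \<le> Re (\<Sum>k<n. D k)\<close> by simp
    qed
    then show "(norm (\<Sum>j<n. \<Phi> (x j) (\<xi> j)))\<^sup>2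
        \<le> Re (\<Sum>i<n. \<Sum>j<n. cinner (\<xi> i) (\<phi> (ip (x i) (x j)) (\<xi> j)))"
      by (cases "n = 0") (simp_all add: D_def y_def)
  qed
next
  assume R: ?R
  show ?L
    unfolding completely_semi_phi_map_def mpos_op_def
  proof (intro allI impI conjI)
    fix n and x :: "nat \<Rightarrow> nat \<Rightarrow> 'e" and \<xi> :: "nat \<Rightarrow> 'h"
    assume x: "\<forall>i<n. \<forall>j<n. x i j \<in> X"
    let ?S = "\<Sum>i<n. \<Sum>j<n. cinner (\<xi> i) (\<phi> (\<Sum>k<n. ip (x k i) (x k j)) (\<xi> j)
        - (\<Sum>k<n. cadjoint (\<Phi> (x k i)) (\<Phi> (x k j) (\<xi> j))))"
    have eq: "?S = (\<Sum>k<n. (\<Sum>i<n. \<Sum>j<n. cinner (\<xi> i) (\<phi> (ip (x k i) (x k j)) (\<xi> j)))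
        - complex_of_real ((norm (\<Sum>j<n. \<Phi> (x k j) (\<xi> j)))\<^sup>2))"
      by (rule semi_form_eq) (use x \<Phi> in blast)
    show "Im ?S = 0"
      unfolding eq Im_sum minus_complex.sel by (intro sum.neutral ballI) (simp only: gram_real[unfolded Im_sum] Im_complex_of_real diff_self)
    show "0 \<le> Re ?S"
      unfolding eq Re_sum minus_complex.sel Re_complex_of_real
    proof (intro sum_nonneg)
      fix k assume "k \<in> {..<n}"
      then have "(norm (\<Sum>j<n. \<Phi> (x k j) (\<xi> j)))\<^sup>2
          \<le> Re (\<Sum>i<n. \<Sum>j<n. cinner (\<xi> i) (\<phi> (ip (x k i) (x k j)) (\<xi> j)))"
        using R[rule_format, of n "x k" \<xi>] x by simp
      then show "0 \<le> (\<Sum>i<n. \<Sum>j<n. Re (cinner (\<xi> i) (\<phi> (ip (x k i) (x k j)) (\<xi> j))))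
          - (norm (\<Sum>j<n. \<Phi> (x k j) (\<xi> j)))\<^sup>2"
        by simp
    qed
  qed
qed

theorem theorem2p4:
  fixes act :: "'e::complex_vector \<Rightarrow> 'a::cstar_algebra \<Rightarrow> 'e"
    and ip :: "'e \<Rightarrow> 'e \<Rightarrow> 'a"
    and F :: "'e set"
    and \<phi> :: "'a \<Rightarrow> 'h1::chilbert_space \<Rightarrow> 'h1"
    and \<Phi> :: "'e \<Rightarrow> 'h1 \<Rightarrow> 'h2::chilbert_space"
  assumes E: "hilbert_module act ip"
    and F: "closed_submodule act ip F"
    and F_nontriv: "F \<noteq> {0}"
    and cp: "completely_positive \<phi>"
    and Phi_bdd: "\<forall>x\<in>F. bounded_clinear (\<Phi> x)"
    and Phi_semi: "completely_semi_phi_map ip \<phi> F \<Phi>"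
  shows "\<exists>\<Phi>'::'e \<Rightarrow> 'h1 \<Rightarrow> 'h2.
           (\<forall>x. bounded_clinear (\<Phi>' x)) \<and>
           completely_semi_phi_map ip \<phi> UNIV \<Phi>' \<and>
           (\<forall>x\<in>F. \<Phi>' x = \<Phi> x) \<and>
           ((phi_map ip \<phi> F \<Phi> \<and> (\<forall>z\<in>orth_compl ip F. \<forall>x. \<phi> (ip z x) = (\<lambda>h. 0))) \<longrightarrow>
              (\<forall>z\<in>orth_compl ip F. \<Phi>' z = (\<lambda>h. 0)) \<and>
              (\<forall>x. \<forall>y\<in>{u + v | u v. u \<in> F \<and> v \<in> orth_compl ip F}.
                 cadjoint (\<Phi>' x) \<circ> \<Phi>' y = \<phi> (ip x y) \<and>
                 cadjoint (\<Phi>' y) \<circ> \<Phi>' x = \<phi> (ip y x)))"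
proof -
  interpret cp_module \<phi> act ip by unfold_locales (fact cp E)+
  have F0: "0 \<in> F" using F by (simp add: closed_submodule_def)
  have row: "(norm (\<Sum>j<n. \<Phi> (x j) (\<xi> j)))\<^sup>2
      \<le> Re (\<Sum>i<n. \<Sum>j<n. cinner (\<xi> i) (\<phi> (ip (x i) (x j)) (\<xi> j)))"
    if "\<And>j. j < n \<Longrightarrow> x j \<in> F" for n :: nat and x \<xi>
    using Phi_semi Phi_bdd that by (simp only: completely_semi_phi_map_iff[OF F0, of \<Phi>]) blast
  let ?\<kappa> = "\<lambda>x y. \<phi> (ip x y)"
  define M :: "('e \<times> 'h1) list set" where "M = {l. \<forall>p\<in>set l. fst p \<in> F}"
  \<comment> \<open>The default 0 outside \<open>F\<close> makes \<open>T\<close> additive and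
    homogeneous on all lists; on \<open>M\<close> it never occurs.\<close>
  define T where "T l = (\<Sum>(x, \<xi>)\<leftarrow>l. if x \<in> F then \<Phi> x \<xi> else 0)" for l
  have M: "M \<noteq> {}" "u \<in> M \<Longrightarrow> v \<in> M \<Longrightarrow> u @ v \<in> M" "u \<in> M \<Longrightarrow> lsmul c u \<in> M" for u v c
    by (auto simp: M_def lsmul_def intro: exI[of _ "[]"])
  have T_add: "T (u @ v) = T u + T v" for u v by (simp add: T_def)
  have T_smul: "T (lsmul c u) = c *\<^sub>C T u" for c u
    by (induction u) (use Phi_bdd in \<open>auto simp: T_def lsmul_def bounded_clinear_def scaleC_add_right\<close>)
  have T_le: "(norm (T u))\<^sup>2 \<le> Re (kform ?\<kappa> u u)" if "u \<in> M" for u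
  proof -
    have u: "map (\<lambda>i. (fst (u ! i), snd (u ! i))) [0..<length u] = u" by (simp add: map_nth)
    have uF: "\<forall>j<length u. fst (u ! j) \<in> F" using that by (simp add: M_def)
    have "T u = (\<Sum>j<length u. \<Phi> (fst (u ! j)) (snd (u ! j)))"
      unfolding T_def sum_list_sum_nth using uF
      by (simp add: case_prod_unfold atLeast0LessThan)
    moreover have "kform ?\<kappa> u u = (\<Sum>i<length u. \<Sum>j<length u.
        cinner (snd (u ! i)) (\<phi> (ip (fst (u ! i)) (fst (u ! j))) (snd (u ! j))))"
      using kform_map_upt[of ?\<kappa> "\<lambda>i. fst (u ! i)" "\<lambda>i. snd (u ! i)" "length u"] unfolding u .
    ultimately show ?thesis
      using row[OF uF[rule_format], where \<xi> = "\<lambda>j. snd (u ! j)"] by simp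
  qed
  obtain S where S_add: "\<And>u v. S (u @ v) = S u + S v" and S_smul: "\<And>c u. S (lsmul c u) = c *\<^sub>C S u"
    and S_le: "\<And>u. (norm (S u))\<^sup>2 \<le> Re (kform ?\<kappa> u u)" and S_M: "\<And>u. u \<in> M \<Longrightarrow> S u = T u"
    and S_iso: "(\<forall>u\<in>M. \<forall>v\<in>M. cinner (T u) (T v) = kform ?\<kappa> u v) \<longrightarrow>
      (\<forall>v. \<forall>u\<in>M. cinner (S v) (T u) = kform ?\<kappa> v u)"
    using tensor.contraction_extension[of M T, OF M T_add T_smul T_le] by blast
  \<comment> \<open>Lists are only formal sums, so tensor identities hold up to null vectors of the
    form; \<open>S_le\<close> makes \<open>S\<close> vanish on these.\<close>
  have S_cong: "S u = S v" if "\<And>w. kform ?\<kappa> u w = kform ?\<kappa> v w" for u v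
  proof -
    have "kform ?\<kappa> (u @ lsmul (-1) v) w = 0" for w
      by (simp only: tensor.add_left tensor.smul_left that[of w]) simp
    then have "(norm (S (u @ lsmul (-1) v)))\<^sup>2 \<le> 0" using S_le[of "u @ lsmul (-1) v"] by simp
    then show ?thesis by (simp add: S_add S_smul)
  qed
  define \<Phi>' where "\<Phi>' x \<xi> = S [(x, \<xi>)]" for x \<xi>
  have sq_le: "(norm (\<Phi>' x \<xi>))\<^sup>2 \<le> Re (cinner \<xi> (\<phi> (ip x x) \<xi>))" for x \<xi>
    using S_le[of "[(x, \<xi>)]"] by (simp add: \<Phi>'_def)
  have bdd: "bounded_clinear (\<Phi>' x)" for x
    unfolding bounded_clinear_def
  proof (intro conjI allI)
    fix \<xi> \<eta> c
    have "S [(x, \<xi> + \<eta>)] = S ([(x, \<xi>)] @ [(x, \<eta>)])"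
      by (rule S_cong) (simp add: kform_def cinner_add_left sum_list_addf case_prod_unfold)
    then show "\<Phi>' x (\<xi> + \<eta>) = \<Phi>' x \<xi> + \<Phi>' x \<eta>" unfolding \<Phi>'_def S_add .
    show "\<Phi>' x (c *\<^sub>C \<xi>) = c *\<^sub>C \<Phi>' x \<xi>" using S_smul[of c "[(x, \<xi>)]"] by (simp add: \<Phi>'_def lsmul_def)
  next
    obtain K where K: "\<And>\<xi>. norm (\<phi> (ip x x) \<xi>) \<le> norm \<xi> * K"
      using phi_bounded[of "ip x x"] unfolding bounded_clinear_def by blast
    have "norm (\<Phi>' x \<xi>) \<le> norm \<xi> * sqrt \<bar>K\<bar>" for \<xi>
    proof -
      have "(norm (\<Phi>' x \<xi>))\<^sup>2 \<le> norm \<xi> * norm (\<phi> (ip x x) \<xi>)"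
        using sq_le[of x \<xi>] complex_Re_le_cmod[of "cinner \<xi> (\<phi> (ip x x) \<xi>)"]
          cinner_cauchy_schwarz[of \<xi> "\<phi> (ip x x) \<xi>"] by linarith
      also have "\<dots> \<le> norm \<xi> * (norm \<xi> * \<bar>K\<bar>)"
        by (intro mult_left_mono order_trans[OF K]) auto
      finally have "norm (\<Phi>' x \<xi>) \<le> sqrt (norm \<xi> * (norm \<xi> * \<bar>K\<bar>))" by (rule real_le_rsqrt)
      then show ?thesis by (simp add: real_sqrt_mult flip: mult.assoc)
    qed
    then show "\<exists>K. \<forall>\<xi>. norm (\<Phi>' x \<xi>) \<le> norm \<xi> * K" by blast
  qed
  moreover have "completely_semi_phi_map ip \<phi> UNIV \<Phi>'"
    unfolding completely_semi_phi_map_iff[OF UNIV_I bdd]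
  proof (intro allI impI)
    fix n x \<xi>
    have "S [] = 0" using S_add[of "[]" "[]"] by simp
    then have "(\<Sum>j<n. \<Phi>' (x j) (\<xi> j)) = S (map (\<lambda>j. (x j, \<xi> j)) [0..<n])"
      by (induction n) (simp_all add: S_add \<Phi>'_def)
    then show "(norm (\<Sum>j<n. \<Phi>' (x j) (\<xi> j)))\<^sup>2
        \<le> Re (\<Sum>i<n. \<Sum>j<n. cinner (\<xi> i) (\<phi> (ip (x i) (x j)) (\<xi> j)))"
      using S_le[of "map (\<lambda>j. (x j, \<xi> j)) [0..<n]"] by (simp only: kform_map_upt)
  qed
  moreover have ext: "\<Phi>' x = \<Phi> x" if "x \<in> F" for x
  proof
    show "\<Phi>' x \<xi> = \<Phi> x \<xi>" for \<xi> using S_M[of "[(x, \<xi>)]"] that by (simp add: \<Phi>'_def M_def T_def)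
  qed
  moreover have "(\<forall>z\<in>orth_compl ip F. \<Phi>' z = (\<lambda>h. 0)) \<and>
      (\<forall>x. \<forall>y\<in>{u + v | u v. u \<in> F \<and> v \<in> orth_compl ip F}.
        cadjoint (\<Phi>' x) \<circ> \<Phi>' y = \<phi> (ip x y) \<and> cadjoint (\<Phi>' y) \<circ> \<Phi>' x = \<phi> (ip y x))"
    if phi: "phi_map ip \<phi> F \<Phi>" and null: "\<forall>z\<in>orth_compl ip F. \<forall>x. \<phi> (ip z x) = (\<lambda>h. 0)"
  proof (intro conjI ballI allI)
    fix z assume z: "z \<in> orth_compl ip F"
    show "\<Phi>' z = (\<lambda>h. 0)"
    proof
      \<comment> \<open>\<open>null\<close> with \<open>x = z\<close> gives
        \<open>\<phi> (ip z z) = 0\<close>, the upper bound in \<open>sq_le\<close>.\<close>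
      show "\<Phi>' z h = 0" for h using sq_le[of z h] null z by simp
    qed
  next
    fix x y assume "y \<in> {u + v | u v. u \<in> F \<and> v \<in> orth_compl ip F}"
    then obtain u v where y: "y = u + v" and u: "u \<in> F" and v: "v \<in> orth_compl ip F" by blast
    have \<Phi>_ip: "cinner (\<Phi> a \<xi>) (\<Phi> b \<eta>) = cinner \<xi> (\<phi> (ip a b) \<eta>)" if "a \<in> F" "b \<in> F" for a b \<xi> \<eta>
    proof -
      have "cadjoint (\<Phi> a) (\<Phi> b \<eta>) = \<phi> (ip a b) \<eta>"
        using phi that unfolding phi_map_def by (metis comp_apply)
      then show ?thesis using cinner_cadjoint(2) Phi_bdd that by metis
    qed
    \<comment> \<open>For a \<open>\<phi>\<close>-map \<open>T\<close> is isometric on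
      \<open>M\<close>; this is the premise of \<open>S_iso\<close>, whose pairing allows an
      arbitrary left argument.\<close>
    have "cinner (T l) (T l') = kform ?\<kappa> l l'" if l: "l \<in> M" "l' \<in> M" for l l'
    proof -
      have "cinner (T l) (T l') = (\<Sum>p\<leftarrow>l. \<Sum>q\<leftarrow>l'. cinner
          (if fst p \<in> F then \<Phi> (fst p) (snd p) else 0) (if fst q \<in> F then \<Phi> (fst q) (snd q) else 0))"
        by (simp only: T_def cinner_sum_list_left map_map comp_def case_prod_unfold)
          (simp only: cinner_sum_list_right map_map comp_def)
      also have "\<dots> = (\<Sum>p\<leftarrow>l. \<Sum>q\<leftarrow>l'. cinner (snd p) (\<phi> (ip (fst p) (fst q)) (snd q)))"
        by (intro arg_cong[of _ _ sum_list] map_cong refl) (use l in \<open>simp add: M_def \<Phi>_ip\<close>)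
      finally show ?thesis by (simp only: kform_def case_prod_unfold)
    qed
    then have iso: "cinner (S l) (T l') = kform ?\<kappa> l l'" if "l' \<in> M" for l l'
      using S_iso that by blast
    have pair: "cinner (\<Phi>' x \<xi>) (\<Phi>' y \<eta>) = cinner \<xi> (\<phi> (ip x y) \<eta>)" for \<xi> \<eta>
    proof -
      \<comment> \<open>Since \<open>\<phi> (ip v w) = 0\<close> for every \<open>w\<close>, the
        component \<open>v\<close> is invisible to the form and \<open>y\<close> may be replaced by
        \<open>u\<close> in \<open>F\<close>, where \<open>S\<close> is \<open>T\<close>.\<close>
      have "S [(y, \<eta>)] = S [(u, \<eta>)]"
        by (rule S_cong) (use null v in \<open>simp add: kform_def y ip_add_left phi_add\<close>)
      then have "\<Phi>' y \<eta> = T [(u, \<eta>)]" using S_M[of "[(u, \<eta>)]"] u by (simp add: \<Phi>'_def M_def)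
      then have "cinner (\<Phi>' x \<xi>) (\<Phi>' y \<eta>) = cinner \<xi> (\<phi> (ip x u) \<eta>)"
        using iso[of "[(u, \<eta>)]" "[(x, \<xi>)]"] u by (simp add: \<Phi>'_def M_def)
      \<comment> \<open>\<open>null\<close> speaks of \<open>ip v x\<close>;
        \<open>hermitian\<close> transfers it to the swapped arguments.\<close>
      moreover have "cinner \<xi> (\<phi> (ip x v) \<eta>) = 0"
        by (subst hermitian) (use null v in \<open>simp add: cstar_ip\<close>)
      ultimately show ?thesis by (simp add: y ip_add_right phi_add cinner_add_right)
    qed
    show "cadjoint (\<Phi>' x) \<circ> \<Phi>' y = \<phi> (ip x y)"
      by (intro HOL.ext cinner_ext) (simp add: cinner_cadjoint bdd pair)
    \<comment> \<open>The second identity is the complex conjugate of \<open>pair\<close>.\<close>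
    show "cadjoint (\<Phi>' y) \<circ> \<Phi>' x = \<phi> (ip y x)"
    proof (intro HOL.ext cinner_ext)
      fix \<xi> \<eta>
      have "cinner \<eta> ((cadjoint (\<Phi>' y) \<circ> \<Phi>' x) \<xi>) = cnj (cinner (\<Phi>' x \<xi>) (\<Phi>' y \<eta>))"
        by (simp add: cinner_cadjoint bdd flip: cinner_commute)
      also have "\<dots> = cinner \<eta> (\<phi> (ip y x) \<xi>)"
        unfolding pair by (subst hermitian[of \<eta>]) (simp add: cstar_ip)
      finally show "cinner \<eta> ((cadjoint (\<Phi>' y) \<circ> \<Phi>' x) \<xi>) = cinner \<eta> (\<phi> (ip y x) \<xi>)" .
    qed
  qed
  ultimately show ?thesis by (intro exI[of _ \<Phi>']) blast
qed

end
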